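(* Let $(c_1,c_2):[0,T]\times\mathbb{R}^n\to\mathbb{R}^2$ be a continuous function. The condition "for every $(t_*,x_* )\in[0,T]\times\mathbb{R}^n$ there exists a motion $y^{(c)}(\cdot)\in\mathrm{Sol}(t_*,x_* )$ such that $c_i(t,y^{(c)}(t))=c_i(t_*,x_* )$ for all $t\in[t_*,T]$, $i=1,2$" holds if and only if for every $(t,x)\in[0,T)\times\mathbb{R}^n$ $$\inf_{w\in\mathcal{F}(t,x)}\mathrm{d}_{abs}(c_1,c_2)(t,x;w)=0.$$
   Context: Consider the controlled system $\dot x=f(t,x,u)+g(t,x,v)$, $t\in[0,T]$, $x\in\mathbb{R}^n$, $u\in P$, $v\in Q$. The sets $P$ and $Q$ are (nonempty) compact; $f,g$ are continuous, Lipschitz continuous with respect to $x$, and satisfy the sublinear growth condition with respect to $x$. Let $\mathcal{U}$ (resp. $\mathcal{V}$) be the set of measurable functions $[0,T]\to P$ (resp. $[0,T]\to Q$). For $u\in\mathcal{U}$, $v\in\mathcal{V}$, $x(\cdot,t_0,x_0,u,v)$ is the solution of $\dot x(t)=f(t,x(t),u(t))+g(t,x(t),v(t))$, $x(t_0)=x_0$, and $\mathrm{Sol}(t_*,x_* ):=\mathrm{cl}\{x(\cdot,t_*,x_*,u,v):u\in\mathcal{U},v\in\mathcal{V}\}$, the closure being taken in the space of continuous vector functions on $[0,T]$. $\mathcal{F}(t,x):=\mathrm{co}\{f(t,x,u)+g(t,x,v):u\in P,\ v\in Q\}$ (convex hull). The modulus derivative of $(c_1,c_2)$ at $(t,x)$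 in the direction $w\in\mathbb{R}^n$ is $$\mathrm{d}_{abs}(c_1,c_2)(t,x;w):=\liminf_{\delta\downarrow0,\,w'\to w}\frac{|c_1(t+\delta,x+\delta w')-c_1(t,x)|+|c_2(t+\delta,x+\delta w')-c_2(t,x)|}{\delta}.$$ *)

theory Defs
  imports "HOL-Analysis.Analysis"
begin

text \<open>
  Standing regularity of one summand of the dynamics on \<open>[0,T] \<times> \<real>\<^sup>n \<times> P\<close>: joint continuity,
  and Lipschitz continuity and sublinear growth in the state, with constants that are uniform
  in time and control.  Values outside this domain are irrelevant.
\<close>

definition regular_dynamics ::
  "real \<Rightarrow> 'p::metric_space set \<Rightarrow> (real \<Rightarrow> real^'n \<Rightarrow> 'p \<Rightarrow> real^'n) \<Rightarrow> bool" where
  "regular_dynamics T P f \<longleftrightarrow>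
     continuous_on ({0..T} \<times> UNIV \<times> P) (\<lambda>(t, x, u). f t x u) \<and>
     (\<exists>L. \<forall>t\<in>{0..T}. \<forall>u\<in>P. L-lipschitz_on UNIV (\<lambda>x. f t x u)) \<and>
     (\<exists>K. \<forall>t\<in>{0..T}. \<forall>x. \<forall>u\<in>P. norm (f t x u) \<le> K * (1 + norm x))"

text \<open>Measurable means Lebesgue measurable; two controls may differ arbitrarily off \<open>[0,T]\<close>.\<close>

definition controls :: "real \<Rightarrow> 'p::metric_space set \<Rightarrow> (real \<Rightarrow> 'p) set" where
  "controls T P = lebesgue_on {0..T} \<rightarrow>\<^sub>M restrict_space borel P"

text \<open>
  Caratheodory solutions on all of \<open>[0,T]\<close>, also to the left of the initial time.  The integral
  equation, with a Lebesgue integrable right-hand side, says that \<open>x\<close> is absolutely continuous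
  and satisfies the differential equation almost everywhere.
\<close>

definition solution ::
  "real \<Rightarrow> (real \<Rightarrow> real^'n \<Rightarrow> 'p \<Rightarrow> real^'n) \<Rightarrow> (real \<Rightarrow> real^'n \<Rightarrow> 'q \<Rightarrow> real^'n) \<Rightarrow>
   real \<Rightarrow> real^'n \<Rightarrow> (real \<Rightarrow> 'p) \<Rightarrow> (real \<Rightarrow> 'q) \<Rightarrow> (real \<Rightarrow> real^'n) \<Rightarrow> bool" where
  "solution T f g t0 x0 u v x \<longleftrightarrow>
     x t0 = x0 \<and>
     (\<lambda>r. f r (x r) (u r) + g r (x r) (v r)) absolutely_integrable_on {0..T} \<and>
     (\<forall>s t. 0 \<le> s \<and> s \<le> t \<and> t \<le> T \<longrightarrow>
        x t - x s = integral {s..t} (\<lambda>r. f r (x r) (u r) + g r (x r) (v r)))"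

text \<open>
  The closure is taken in the space of continuous functions \<open>[0,T] \<rightarrow> \<real>\<^sup>n\<close> with the supremum
  metric.  The elements of \<open>cfunspace\<close> are extensional functions, hence the \<open>restrict\<close>.
\<close>

definition Sol ::
  "real \<Rightarrow> 'p::metric_space set \<Rightarrow> 'q::metric_space set \<Rightarrow>
   (real \<Rightarrow> real^'n \<Rightarrow> 'p \<Rightarrow> real^'n) \<Rightarrow> (real \<Rightarrow> real^'n \<Rightarrow> 'q \<Rightarrow> real^'n) \<Rightarrow>
   real \<Rightarrow> real^'n \<Rightarrow> (real \<Rightarrow> real^'n) set" where
  "Sol T P Q f g t0 x0 =
     mtopology_of (cfunspace (top_of_set {0..T}) euclidean_metric) closure_of
       {restrict x {0..T} | x u v.
          u \<in> controls T P \<and> v \<in> controls T Q \<and> solution T f g t0 x0 u v x}"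

definition velocities ::
  "'p set \<Rightarrow> 'q set \<Rightarrow>
   (real \<Rightarrow> real^'n \<Rightarrow> 'p \<Rightarrow> real^'n) \<Rightarrow> (real \<Rightarrow> real^'n \<Rightarrow> 'q \<Rightarrow> real^'n) \<Rightarrow>
   real \<Rightarrow> real^'n \<Rightarrow> (real^'n) set" where
  "velocities P Q f g t x = convex hull {f t x u + g t x v | u v. u \<in> P \<and> v \<in> Q}"

text \<open>
  The lower limit is extended-real valued.  For \<open>t < T\<close> only \<open>\<delta>\<close> with \<open>t + \<delta> \<le> T\<close> matter, so the
  values of \<open>c1\<close> and \<open>c2\<close> at times outside \<open>[0,T]\<close> play no role.
\<close>

definition d_abs ::
  "(real \<Rightarrow> real^'n \<Rightarrow> real) \<Rightarrow> (real \<Rightarrow> real^'n \<Rightarrow> real) \<Rightarrow>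
   real \<Rightarrow> real^'n \<Rightarrow> real^'n \<Rightarrow> ereal" where
  "d_abs c1 c2 t x w =
     Liminf (at_right 0 \<times>\<^sub>F nhds w)
       (\<lambda>(\<delta>, w'). ereal ((\<bar>c1 (t + \<delta>) (x + \<delta> *\<^sub>R w') - c1 t x\<bar> +
                           \<bar>c2 (t + \<delta>) (x + \<delta> *\<^sub>R w') - c2 t x\<bar>) / \<delta>))"

end

theory Submission
  imports Defs "HOL-Complex_Analysis.Great_Picard"
begin

text \<open>
  Suppose first that the level condition on the derivative holds.  At every point with \<open>t < T\<close> it supplies
  arbitrarily short steps \<open>(t, x)\<close> to \<open>(s, x')\<close> whose velocity is nearly in the convex hull of the velocities and
  along which \<open>(c1, c2)\<close> changes by at most \<open>\<kappa> * (s - t)\<close>.  In other words, the velocity \<open>(1, w, 0)\<close> is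
  tangent to the graph of \<open>(c1, c2)\<close>, which is a closed set, and the claim is that this graph is viable.
  Such steps are stable under small changes of the starting point, so on compact sets their length is
  bounded below (\<open>uniform_level_step\<close>), and finitely many of them form a polygon that reaches a neighbourhood
  of \<open>T\<close> and along which \<open>(c1, c2)\<close> is nearly constant.

  The velocities of the polygon are convexified, but they can be imitated by a true trajectory: on a
  short interval the constant controls that enter a convex combination are run through one after the
  other, each for a time proportional to its weight (\<open>steer_convexified_velocity\<close>).  Thus the
  approximating motions are trajectories from the outset, and their uniform limit is an element of the
  closure \<open>Sol\<close> by construction
  (\<open>approximate_level_motion\<close>, \<open>level_motion\<close>).

  Conversely, a motion \<open>y\<close> in \<open>Sol\<close> has difference quotients at its initial time that accumulate at some
  \<open>w\<close> in the compact set of convexified velocities (\<open>Sol_initial_velocity\<close>).  If \<open>c1\<close> and \<open>c2\<close> are constant along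
  \<open>y\<close>, then the quotients in the modulus derivative vanish along this sequence, so the lower limit in the
  direction \<open>w\<close>, which cannot be negative, is zero.
\<close>

section \<open>Integral equations with a Lipschitz right-hand side\<close>

lemma integral_exp_weight_le:
  fixes B t0 t :: real
  assumes "B > 0"
  shows "((\<lambda>r. exp (2 * B * \<bar>r - t0\<bar>)) has_integral (exp (2 * B * \<bar>t - t0\<bar>) - 1) / (2 * B))
           {min t0 t..max t0 t}"
proof (cases "t0 \<le> t")
  case True
  have "((\<lambda>r. exp (2 * B * (r - t0))) has_integral
          (exp (2 * B * (t - t0)) / (2 * B) - exp (2 * B * (t0 - t0)) / (2 * B))) {t0..t}"
    using assms True
    by (intro fundamental_theorem_of_calculus)
       (auto intro!: derivative_eq_intros simp flip: has_real_derivative_iff_has_vector_derivative)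
  then have "((\<lambda>r. exp (2 * B * \<bar>r - t0\<bar>)) has_integral
          (exp (2 * B * (t - t0)) / (2 * B) - exp (2 * B * (t0 - t0)) / (2 * B))) {t0..t}"
    by (rule has_integral_eq[rotated]) auto
  with True show ?thesis by (simp add: min_def max_def diff_divide_distrib)
next
  case False
  have "((\<lambda>r. exp (2 * B * (t0 - r))) has_integral
          (- exp (2 * B * (t0 - t0)) / (2 * B) - - exp (2 * B * (t0 - t)) / (2 * B))) {t..t0}"
    using assms False
    by (intro fundamental_theorem_of_calculus)
       (auto intro!: derivative_eq_intros simp flip: has_real_derivative_iff_has_vector_derivative)
  then have "((\<lambda>r. exp (2 * B * \<bar>r - t0\<bar>)) has_integral
          (- exp (2 * B * (t0 - t0)) / (2 * B) - - exp (2 * B * (t0 - t)) / (2 * B))) {t..t0}"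
    by (rule has_integral_eq[rotated]) auto
  with False show ?thesis by (simp add: min_def max_def diff_divide_distrib)
qed

text \<open>
  The weight \<open>exp (2 * B * \<bar>r - t0\<bar>)\<close> gains a factor \<open>1 / (2 * B)\<close> under integration from \<open>t0\<close>, in both
  time directions.  For a right-hand side with Lipschitz or growth constant \<open>B\<close>, the factor \<open>1/2\<close> that
  remains makes the Picard operator a contraction on the whole interval, and it also replaces
  Gronwall's inequality in the a priori bound of trajectories.
\<close>

lemma norm_integral_exp_weight_le:
  fixes F :: "real \<Rightarrow> 'a::euclidean_space"
  assumes "B > 0" "C \<ge> 0" "F integrable_on {min t0 t..max t0 t}"
    and le: "\<And>r. r \<in> {min t0 t..max t0 t} \<Longrightarrow> norm (F r) \<le> C * exp (2 * B * \<bar>r - t0\<bar>)"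
  shows "norm (integral {min t0 t..max t0 t} F) \<le> C * exp (2 * B * \<bar>t - t0\<bar>) / (2 * B)"
proof -
  note w = has_integral_mult_right[OF integral_exp_weight_le[OF \<open>B > 0\<close>, of t0 t], of C]
  have "norm (integral {min t0 t..max t0 t} F)
      \<le> integral {min t0 t..max t0 t} (\<lambda>r. C * exp (2 * B * \<bar>r - t0\<bar>))"
    using assms(3) w le by (intro integral_norm_bound_integral) auto
  also have "\<dots> = C * ((exp (2 * B * \<bar>t - t0\<bar>) - 1) / (2 * B))"
    using w by (rule integral_unique)
  also have "\<dots> \<le> C * exp (2 * B * \<bar>t - t0\<bar>) / (2 * B)"
    using assms(1,2) by (simp add: divide_simps right_diff_distrib)
  finally show ?thesis .
qed

lemma norm_indefinite_integral_diff:
  fixes F :: "real \<Rightarrow> 'a::banach"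
  assumes "F integrable_on {0..T}" "t0 \<in> {0..T}" "t \<in> {0..T}"
  shows "norm (integral {0..t} F - integral {0..t0} F) = norm (integral {min t0 t..max t0 t} F)"
proof -
  have *: "integral {0..b} F - integral {0..a} F = integral {a..b} F" if "0 \<le> a" "a \<le> b" "b \<le> T" for a b
    using Henstock_Kurzweil_Integration.integral_combine[of 0 a b F] that
      integrable_on_subinterval[OF assms(1), of 0 b] by (auto simp: algebra_simps)
  show ?thesis
  proof (cases "t0 \<le> t")
    case True
    then show ?thesis using *[of t0 t] assms by simp
  next
    case False
    then have "integral {0..t0} F - integral {0..t} F = integral {t..t0} F"
      using *[of t t0] assms by simp
    with False show ?thesis
      by (metis max.absorb1 min.absorb2 linorder_linear norm_minus_commute)
  qed
qed

text \<open>
  The Picard operator, written for \<open>z\<close> with \<open>x t = exp (2 * L * \<bar>t - t0\<bar>) *\<^sub>R z t\<close>, is a contraction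
  with factor \<open>1/2\<close> for the supremum norm.  The unknown \<open>z\<close> lives in the Banach space of bounded
  continuous functions on the real line; the image is therefore extended by its boundary
  values beyond \<open>[0,T]\<close>.
\<close>

lemma picard_lindelof:
  fixes H :: "real \<Rightarrow> 'a::euclidean_space \<Rightarrow> 'a"
  assumes "0 \<le> T" "t0 \<in> {0..T}" "L > 0"
    and cont: "continuous_on ({0..T} \<times> UNIV) (\<lambda>(t, x). H t x)"
    and lip: "\<And>t x y. t \<in> {0..T} \<Longrightarrow> norm (H t x - H t y) \<le> L * norm (x - y)"
  obtains x where "continuous_on {0..T} x" "x t0 = x0"
    "\<And>s t. 0 \<le> s \<Longrightarrow> s \<le> t \<Longrightarrow> t \<le> T \<Longrightarrow> x t - x s = integral {s..t} (\<lambda>r. H r (x r))"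
proof -
  define W where "W t = exp (2 * L * \<bar>t - t0\<bar>)" for t
  define cl where "cl t = max 0 (min T t)" for t :: real
  define J where "J z t = integral {0..t} (\<lambda>r. H r (W r *\<^sub>R apply_bcontfun z r))"
    for z :: "real \<Rightarrow>\<^sub>C 'a" and t
  define \<Psi> where "\<Psi> z t = (x0 + (J z (cl t) - J z t0)) /\<^sub>R W (cl t)" for z t
  have W: "W t > 0" for t by (simp add: W_def)
  have cl: "cl t \<in> {0..T}" for t using assms(1) by (auto simp: cl_def)
  have clid: "cl t = t" if "t \<in> {0..T}" for t using that by (auto simp: cl_def)
  have Hx: "continuous_on {0..T} (\<lambda>r. H r (x r))" if "continuous_on {0..T} x" for x
    by (rule continuous_on_compose2[OF cont, of _ "\<lambda>r. (r, x r)", simplified])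
       (auto intro!: continuous_intros that)
  have contW: "continuous_on A W" for A unfolding W_def by (intro continuous_intros)
  have Hz: "continuous_on {0..T} (\<lambda>r. H r (W r *\<^sub>R apply_bcontfun z r))" for z
    by (intro Hx continuous_intros contW) auto
  then have int: "(\<lambda>r. H r (W r *\<^sub>R apply_bcontfun z r)) integrable_on {0..T}" for z
    by (rule integrable_continuous_interval)
  have contJ: "continuous_on {0..T} (J z)" for z
    unfolding J_def by (rule indefinite_integral_continuous_1[OF int])
  have contcl: "continuous_on UNIV cl" unfolding cl_def by (intro continuous_intros)
  have cont\<Psi>': "continuous_on {0..T} (\<lambda>t. (x0 + (J z t - J z t0)) /\<^sub>R W t)" for z
    by (intro continuous_intros contJ contW) (use W in \<open>auto simp: less_imp_neq[symmetric]\<close>)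
  have "\<Psi> z \<in> bcontfun" for z
  proof -
    have "continuous_on UNIV (\<Psi> z)"
      unfolding \<Psi>_def by (rule continuous_on_compose2[OF cont\<Psi>' contcl]) (use cl in auto)
    moreover have "range (\<Psi> z) \<subseteq> (\<lambda>t. (x0 + (J z t - J z t0)) /\<^sub>R W t) ` {0..T}"
      unfolding \<Psi>_def using cl by auto
    then have "bounded (range (\<Psi> z))"
      by (rule bounded_subset[OF compact_imp_bounded[OF compact_continuous_image[OF cont\<Psi>' compact_Icc]]])
    ultimately show ?thesis by (simp add: bcontfun_def)
  qed
  then have app: "apply_bcontfun (Bcontfun (\<Psi> z)) = \<Psi> z" for z
    by (simp add: Bcontfun_inverse)
  have "dist (Bcontfun (\<Psi> z1)) (Bcontfun (\<Psi> z2)) \<le> (1/2) * dist z1 z2" for z1 z2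
  proof (rule dist_bound)
    fix t
    let ?t = "cl t" and ?d = "dist z1 z2"
    let ?F = "\<lambda>r. H r (W r *\<^sub>R apply_bcontfun z1 r) - H r (W r *\<^sub>R apply_bcontfun z2 r)"
    have sub: "{min t0 ?t..max t0 ?t} \<subseteq> {0..T}" using cl[of t] assms(2) by auto
    have JJ: "J z1 s - J z2 s = integral {0..s} ?F" if "s \<in> {0..T}" for s
      unfolding J_def using that
      by (subst integral_diff) (auto intro: integrable_on_subinterval[OF int])
    have "norm ((J z1 ?t - J z1 t0) - (J z2 ?t - J z2 t0))
        = norm (integral {0..?t} ?F - integral {0..t0} ?F)"
      using JJ[OF cl[of t]] JJ[OF assms(2)] by (simp add: algebra_simps)
    also have "\<dots> = norm (integral {min t0 ?t..max t0 ?t} ?F)"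
      using cl assms(2) int by (intro norm_indefinite_integral_diff[of _ T] integrable_diff) auto
    also have "\<dots> \<le> (L * ?d) * exp (2 * L * \<bar>?t - t0\<bar>) / (2 * L)"
    proof (rule norm_integral_exp_weight_le)
      show "?F integrable_on {min t0 ?t..max t0 ?t}"
        by (rule integrable_on_subinterval[OF _ sub]) (intro integrable_diff int)
      fix r assume "r \<in> {min t0 ?t..max t0 ?t}"
      then have "norm (?F r) \<le> L * norm (W r *\<^sub>R apply_bcontfun z1 r - W r *\<^sub>R apply_bcontfun z2 r)"
        using sub by (intro lip) auto
      also have "\<dots> = L * (W r * dist (apply_bcontfun z1 r) (apply_bcontfun z2 r))"
        using W[of r] by (simp add: dist_norm flip: scaleR_right_diff_distrib)
      also have "\<dots> \<le> L * (W r * ?d)"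
        using \<open>L > 0\<close> W[of r] by (intro mult_left_mono dist_bounded) auto
      finally show "norm (?F r) \<le> L * ?d * exp (2 * L * \<bar>r - t0\<bar>)"
        by (simp add: W_def algebra_simps)
    qed (use \<open>L > 0\<close> in auto)
    also have "\<dots> = ?d / 2 * W ?t" using \<open>L > 0\<close> by (simp add: W_def)
    finally have *: "norm ((J z1 ?t - J z1 t0) - (J z2 ?t - J z2 t0)) \<le> ?d / 2 * W ?t" .
    have "dist (\<Psi> z1 t) (\<Psi> z2 t) = norm ((J z1 ?t - J z1 t0) - (J z2 ?t - J z2 t0)) / W ?t"
      using W[of ?t] unfolding \<Psi>_def dist_norm scaleR_right_diff_distrib[symmetric]
      by (simp add: divide_inverse mult.commute)
    also have "\<dots> \<le> ?d / 2" using * W[of ?t] by (simp add: divide_le_eq)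
    finally show "dist (apply_bcontfun (Bcontfun (\<Psi> z1)) t) (apply_bcontfun (Bcontfun (\<Psi> z2)) t)
        \<le> 1/2 * dist z1 z2" by (simp add: app)
  qed
  then obtain z where z: "Bcontfun (\<Psi> z) = z"
    using banach_fix_type[of "1/2" "\<lambda>z. Bcontfun (\<Psi> z)"] by auto
  define x where "x t = W t *\<^sub>R apply_bcontfun z t" for t
  have xt: "x t = x0 + (J z t - J z t0)" if "t \<in> {0..T}" for t
  proof -
    have "apply_bcontfun z t = \<Psi> z t" using app[of z] z by simp
    then show ?thesis unfolding x_def \<Psi>_def clid[OF that] using W[of t] by simp
  qed
  show ?thesis
  proof
    show "continuous_on {0..T} x" unfolding x_def by (intro continuous_intros contW) auto
    show "x t0 = x0" using xt assms(2) by simp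
    fix s t :: real assume st: "0 \<le> s" "s \<le> t" "t \<le> T"
    then have "x t - x s = J z t - J z s" by (simp add: xt)
    also have "\<dots> = integral {s..t} (\<lambda>r. H r (W r *\<^sub>R apply_bcontfun z r))"
      using Henstock_Kurzweil_Integration.integral_combine[of 0 s t "\<lambda>r. H r (W r *\<^sub>R apply_bcontfun z r)"]
        integrable_on_subinterval[OF int, of 0 t] st unfolding J_def by (auto simp: algebra_simps)
    finally show "x t - x s = integral {s..t} (\<lambda>r. H r (x r))" by (simp add: x_def)
  qed
qed

section \<open>Convex hulls and means\<close>

text \<open>
  The closed \<open>e\<close>-neighbourhood of a convex set is convex, so that it contains the hull of every set of
  points that it contains.
\<close>

lemma convex_hull_image_perturb:
  fixes a b :: "'c \<Rightarrow> 'a::real_normed_vector"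
  assumes ab: "\<And>r. r \<in> A \<Longrightarrow> norm (a r - b r) \<le> e" and w: "w \<in> convex hull (a ` A)"
  obtains w' where "w' \<in> convex hull (b ` A)" "norm (w - w') \<le> e"
proof -
  let ?S = "\<Union>x\<in>convex hull (b ` A). \<Union>y\<in>cball 0 e. {x + y}"
  have "convex ?S" by (intro convex_sums convex_convex_hull convex_cball)
  moreover have "a ` A \<subseteq> ?S"
  proof clarsimp
    fix r assume "r \<in> A"
    then have "b r \<in> convex hull (b ` A)" "a r - b r \<in> cball 0 e" using ab by (auto intro: hull_inc)
    then show "\<exists>x\<in>convex hull b ` A. \<exists>y\<in>cball 0 e. a r = x + y"
      by (metis add.commute diff_add_cancel)
  qed
  ultimately have "w \<in> ?S" using hull_minimal[of "a ` A" ?S convex] w by blast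
  then obtain x y where "x \<in> convex hull (b ` A)" "y \<in> cball 0 e" "w = x + y" by blast
  then show ?thesis by (intro that[of x]) auto
qed

text \<open>
  If the mean were outside \<open>C\<close>, a hyperplane would strictly separate it from all values of \<open>F\<close>; integrating this
  inequality gives a contradiction.
\<close>

lemma mean_in_closed_convex:
  fixes F :: "real \<Rightarrow> 'a::euclidean_space"
  assumes "a < b" and C: "convex C" "closed C"
    and F: "F integrable_on {a..b}" "\<And>s. s \<in> {a..b} \<Longrightarrow> F s \<in> C"
  shows "integral {a..b} F /\<^sub>R (b - a) \<in> C"
proof (rule ccontr)
  assume "integral {a..b} F /\<^sub>R (b - a) \<notin> C"
  then obtain n \<gamma> where n: "n \<bullet> (integral {a..b} F /\<^sub>R (b - a)) < \<gamma>" "\<And>x. x \<in> C \<Longrightarrow> \<gamma> < n \<bullet> x"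
    using separating_hyperplane_closed_point[OF C] by blast
  have lin: "bounded_linear (\<lambda>x. n \<bullet> x)" by (rule bounded_linear_inner_right)
  have "\<gamma> * (b - a) = integral {a..b} (\<lambda>s. \<gamma>)" using assms(1) by simp
  also have "\<dots> \<le> integral {a..b} (\<lambda>s. n \<bullet> F s)"
    using integrable_linear[OF F(1) lin] n(2) F(2)
    by (intro integral_le) (auto simp: o_def less_imp_le)
  also have "\<dots> = n \<bullet> integral {a..b} F"
    using integral_linear[OF F(1) lin] by (simp add: o_def)
  also have "\<dots> = (n \<bullet> (integral {a..b} F /\<^sub>R (b - a))) * (b - a)" using assms(1) by simp
  also have "\<dots> < \<gamma> * (b - a)" using n(1) assms(1) by (intro mult_strict_right_mono) auto
  finally show False by simp
qed

lemma norm_integral_le_const: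
  fixes F :: "real \<Rightarrow> 'a::euclidean_space"
  assumes "a \<le> b" "0 \<le> B" "F integrable_on {a..b}" "\<And>s. s \<in> {a..b} \<Longrightarrow> norm (F s) \<le> B"
  shows "norm (integral {a..b} F) \<le> B * (b - a)"
  using has_integral_bound[of B F "integral {a..b} F" a b] assms
  by (simp add: integrable_integral)

section \<open>Trajectories of the control system\<close>

text \<open>
  The two players act jointly in all that follows, so their controls are paired.  Both constants
  are kept positive to serve as exponents of the weights above.
\<close>

locale control_system =
  fixes T :: real
    and P :: "'p::metric_space set" and Q :: "'q::metric_space set"
    and f :: "real \<Rightarrow> real^'n \<Rightarrow> 'p \<Rightarrow> real^'n"
    and g :: "real \<Rightarrow> real^'n \<Rightarrow> 'q \<Rightarrow> real^'n"
    and vel :: "real \<Rightarrow> real^'n \<Rightarrow> 'p \<times> 'q \<Rightarrow> real^'n"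
    and L K :: real
  defines "vel t x r \<equiv> f t x (fst r) + g t x (snd r)"
  assumes T_pos: "0 < T"
    and compact_controls: "compact (P \<times> Q)"
    and controls_nonempty: "P \<times> Q \<noteq> {}"
    and L_pos: "0 < L" and K_pos: "0 < K"
    and vel_continuous: "continuous_on ({0..T} \<times> UNIV \<times> (P \<times> Q)) (\<lambda>(t, x, r). vel t x r)"
    and vel_lipschitz: "\<And>t x y r. t \<in> {0..T} \<Longrightarrow> r \<in> P \<times> Q \<Longrightarrow>
          norm (vel t x r - vel t y r) \<le> L * norm (x - y)"
    and vel_growth: "\<And>t x r. t \<in> {0..T} \<Longrightarrow> r \<in> P \<times> Q \<Longrightarrow> norm (vel t x r) \<le> K * (1 + norm x)"
begin

definition traj :: "real \<Rightarrow> real^'n \<Rightarrow> (real \<Rightarrow> real^'n) \<Rightarrow> bool" where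
  "traj t0 x0 y \<longleftrightarrow> (\<exists>u\<in>controls T P. \<exists>v\<in>controls T Q. solution T f g t0 x0 u v y)"

lemma velocities_eq: "velocities P Q f g t x = convex hull (vel t x ` (P \<times> Q))"
  unfolding velocities_def vel_def by (rule arg_cong[where f="\<lambda>S. convex hull S"]) force

lemma compact_velocities:
  assumes "t \<in> {0..T}"
  shows "compact (velocities P Q f g t x)"
proof -
  have "continuous_on (P \<times> Q) (vel t x)"
    by (rule continuous_on_compose2[OF vel_continuous, of _ "\<lambda>r. (t, x, r)", simplified])
       (use assms in \<open>auto intro!: continuous_intros\<close>)
  then show ?thesis
    unfolding velocities_eq by (intro compact_convex_hull compact_continuous_image compact_controls)
qed

lemma trajE:
  assumes "traj t0 x0 y"
  obtains r where "\<And>s. s \<in> {0..T} \<Longrightarrow> r s \<in> P \<times> Q" "(\<lambda>s. vel s (y s) (r s)) integrable_on {0..T}"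
    "y t0 = x0"
    "\<And>s t. 0 \<le> s \<Longrightarrow> s \<le> t \<Longrightarrow> t \<le> T \<Longrightarrow> y t - y s = integral {s..t} (\<lambda>s. vel s (y s) (r s))"
proof -
  obtain u v where uv: "u \<in> controls T P" "v \<in> controls T Q" "solution T f g t0 x0 u v y"
    using assms unfolding traj_def by blast
  have "u s \<in> P" "v s \<in> Q" if "s \<in> {0..T}" for s
    using uv(1,2) that measurable_space[of u "lebesgue_on {0..T}" "restrict_space borel P" s]
      measurable_space[of v "lebesgue_on {0..T}" "restrict_space borel Q" s]
    unfolding controls_def by (auto simp: space_restrict_space)
  with uv(3) show ?thesis
    by (intro that[of "\<lambda>s. (u s, v s)"])
       (auto simp: solution_def vel_def set_lebesgue_integral_eq_integral)
qed

lemma continuous_on_vel_along: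
  assumes "r \<in> P \<times> Q" "A \<subseteq> {0..T}" "continuous_on A x"
  shows "continuous_on A (\<lambda>s. vel s (x s) r)"
  by (rule continuous_on_compose2[OF vel_continuous, of _ "\<lambda>s. (s, x s, r)", simplified])
     (use assms in \<open>auto intro!: continuous_intros\<close>)

lemma constant_control_solution:
  assumes "r \<in> P \<times> Q" "t0 \<in> {0..T}"
  obtains x where "continuous_on {0..T} x" "x t0 = x0"
    "\<And>s t. 0 \<le> s \<Longrightarrow> s \<le> t \<Longrightarrow> t \<le> T \<Longrightarrow> x t - x s = integral {s..t} (\<lambda>s. vel s (x s) r)"
proof (rule picard_lindelof[of T t0 L "\<lambda>t x. vel t x r" x0])
  have "continuous_on ({0..T} \<times> UNIV) (\<lambda>z. vel (fst z) (snd z) r)"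
    by (rule continuous_on_compose2[OF vel_continuous, of _ "\<lambda>z. (fst z, snd z, r)", simplified])
       (use assms in \<open>auto intro!: continuous_intros\<close>)
  then show "continuous_on ({0..T} \<times> UNIV) (\<lambda>(t, x). vel t x r)" by (simp add: case_prod_beta')
qed (use T_pos assms L_pos vel_lipschitz that in auto)

lemma traj_exists:
  assumes "t0 \<in> {0..T}"
  obtains y where "traj t0 x0 y"
proof -
  obtain p q where pq: "p \<in> P" "q \<in> Q" using controls_nonempty by blast
  obtain x where x: "continuous_on {0..T} x" "x t0 = x0"
    "\<And>s t. 0 \<le> s \<Longrightarrow> s \<le> t \<Longrightarrow> t \<le> T \<Longrightarrow> x t - x s = integral {s..t} (\<lambda>s. vel s (x s) (p, q))"
    using constant_control_solution[of "(p, q)" t0 x0] pq assms by auto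
  have "(\<lambda>s. vel s (x s) (p, q)) absolutely_integrable_on {0..T}"
    using pq x(1) by (intro absolutely_integrable_continuous_real continuous_on_vel_along) auto
  then have "solution T f g t0 x0 (\<lambda>_. p) (\<lambda>_. q) x"
    using x(2,3) by (simp add: solution_def vel_def)
  moreover have "(\<lambda>_. p) \<in> controls T P" "(\<lambda>_. q) \<in> controls T Q"
    using pq unfolding controls_def by (auto intro!: measurable_const simp: space_restrict_space)
  ultimately show ?thesis using that unfolding traj_def by blast
qed

lemma controls_switch:
  assumes "u \<in> controls T P'" "p \<in> P'"
  shows "(\<lambda>s. if s \<le> a then u s else p) \<in> controls T P'"
  unfolding controls_def
proof (rule measurable_If)
  have "{s \<in> space (lebesgue_on {0..T}). s \<le> a} = {0..min a T}" by auto
  then show "{s \<in> space (lebesgue_on {0..T}). s \<le> a} \<in> sets (lebesgue_on {0..T})"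
    by (auto simp: sets_restrict_space_iff)
qed (use assms in \<open>auto simp: controls_def space_restrict_space\<close>)

text \<open>
  A trajectory can be stopped at any time \<open>a\<close> and continued under the constant control \<open>r\<close>.  Repeating
  this produces piecewise constant controls, and these suffice for all approximating motions; so
  differential equations are solved only for constant controls, where the right-hand side is continuous.
\<close>

lemma traj_switch:
  assumes y: "traj t0 x0 y" and a: "t0 \<le> a" "a \<in> {0..T}" "0 \<le> t0" and r: "r \<in> P \<times> Q"
  obtains y' where "traj t0 x0 y'" "\<And>s. s \<le> a \<Longrightarrow> y' s = y s"
    "\<And>s. s \<in> {a..T} \<Longrightarrow> y' s - y' a = integral {a..s} (\<lambda>s. vel s (y' s) r)"
    "(\<lambda>s. vel s (y' s) r) integrable_on {a..T}"
proof -
  obtain p q where pq: "r = (p, q)" "p \<in> P" "q \<in> Q" using r by blast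
  obtain u v where u: "u \<in> controls T P" and v: "v \<in> controls T Q"
    and sol: "solution T f g t0 x0 u v y" using y unfolding traj_def by blast
  obtain z where z: "continuous_on {0..T} z" "z a = y a"
    "\<And>s t. 0 \<le> s \<Longrightarrow> s \<le> t \<Longrightarrow> t \<le> T \<Longrightarrow> z t - z s = integral {s..t} (\<lambda>s. vel s (z s) r)"
    using constant_control_solution[of r a "y a"] r a by auto
  define y' where "y' s = (if s \<le> a then y s else z s)" for s
  define u' where "u' s = (if s \<le> a then u s else p)" for s
  define v' where "v' s = (if s \<le> a then v s else q)" for s
  define G where "G s = vel s (y s) (u s, v s)" for s
  define G' where "G' s = vel s (y' s) (u' s, v' s)" for s
  have y'z: "y' s = z s" if "a \<le> s" for s using that z(2) by (auto simp: y'_def)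
  have G: "G absolutely_integrable_on {0..T}"
    and yG: "\<And>s t. 0 \<le> s \<Longrightarrow> s \<le> t \<Longrightarrow> t \<le> T \<Longrightarrow> y t - y s = integral {s..t} G"
    using sol unfolding solution_def G_def vel_def by auto
  have zint: "(\<lambda>s. vel s (z s) r) absolutely_integrable_on {0..T}"
    using z(1) r by (intro absolutely_integrable_continuous_real continuous_on_vel_along) auto
  have G1: "G' s = G s" if "s \<le> a" for s
    using that by (simp add: G'_def G_def y'_def u'_def v'_def)
  have G2: "G' s = vel s (z s) r" if "a < s" for s
    using that by (simp add: G'_def y'_def u'_def v'_def pq(1))
  have I1: "integral {s..t} G' = y' t - y' s" if "0 \<le> s" "s \<le> t" "t \<le> a" for s t
  proof -
    have "integral {s..t} G' = integral {s..t} G" using that by (intro integral_cong G1) auto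
    with that a show ?thesis by (simp add: yG y'_def)
  qed
  have I2: "integral {s..t} G' = y' t - y' s" if "a \<le> s" "s \<le> t" "t \<le> T" for s t
  proof -
    have "integral {s..t} G' = integral {s..t} (\<lambda>s. vel s (z s) r)"
      by (rule integral_spike[of "{a}"]) (use that G2 in auto)
    with that a show ?thesis by (simp add: z(3) y'z)
  qed
  have G'1: "G' absolutely_integrable_on {0..a}"
    by (rule absolutely_integrable_spike[OF absolutely_integrable_on_subinterval[OF G], of _ _ "{}"])
       (use a G1 in auto)
  have G'2: "G' absolutely_integrable_on {a..T}"
    by (rule absolutely_integrable_spike[OF absolutely_integrable_on_subinterval[OF zint], of _ _ "{a}"])
       (use a G2 in auto)
  have G': "G' absolutely_integrable_on {0..T}"
    using a by (intro absolutely_integrable_on_combine[OF G'1 G'2]) auto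
  have "y' t - y' s = integral {s..t} G'" if "0 \<le> s" "s \<le> t" "t \<le> T" for s t
  proof -
    consider "t \<le> a" | "a \<le> s" | "s \<le> a" "a \<le> t" by linarith
    then show ?thesis
    proof cases
      case 3
      have "G' integrable_on {s..t}"
        using that by (intro integrable_on_subinterval[OF set_lebesgue_integral_eq_integral(1)[OF G']]) auto
      then have "integral {s..a} G' + integral {a..t} G' = integral {s..t} G'"
        using 3 by (intro Henstock_Kurzweil_Integration.integral_combine) auto
      then show ?thesis using I1[of s a] I2[of a t] 3 that by simp
    qed (use that I1 I2 in auto)
  qed
  moreover have "y' t0 = x0" using sol a(1) by (simp add: y'_def solution_def)
  ultimately have "solution T f g t0 x0 u' v' y'"
    using G' unfolding solution_def G'_def vel_def by simp
  moreover have "u' \<in> controls T P" "v' \<in> controls T Q"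
    unfolding u'_def v'_def using u v pq by (auto intro: controls_switch)
  ultimately have "traj t0 x0 y'" unfolding traj_def by blast
  moreover have "y' s - y' a = integral {a..s} (\<lambda>s. vel s (y' s) r)" if "s \<in> {a..T}" for s
  proof -
    have "integral {a..s} (\<lambda>s. vel s (y' s) r) = integral {a..s} (\<lambda>s. vel s (z s) r)"
      by (rule integral_cong) (simp add: y'z)
    then show ?thesis using z(3)[of a s] that a by (simp add: y'z)
  qed
  moreover have "(\<lambda>s. vel s (y' s) r) integrable_on {a..T}"
  proof -
    have "(\<lambda>s. vel s (z s) r) integrable_on {a..T}"
      using a by (intro integrable_on_subinterval[OF set_lebesgue_integral_eq_integral(1)[OF zint]]) auto
    then show ?thesis by (rule integrable_eq) (simp add: y'z)
  qed
  ultimately show ?thesis by (intro that[of y']) (auto simp: y'_def)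
qed

lemma traj_start: "traj t0 x0 y \<Longrightarrow> y t0 = x0"
  by (auto elim: trajE)

lemma traj_continuous:
  assumes "traj t0 x0 y"
  shows "continuous_on {0..T} y"
proof -
  obtain r where r: "(\<lambda>s. vel s (y s) (r s)) integrable_on {0..T}"
    "\<And>s t. 0 \<le> s \<Longrightarrow> s \<le> t \<Longrightarrow> t \<le> T \<Longrightarrow> y t - y s = integral {s..t} (\<lambda>s. vel s (y s) (r s))"
    using assms by (rule trajE) blast
  have "y t = y 0 + integral {0..t} (\<lambda>s. vel s (y s) (r s))" if "t \<in> {0..T}" for t
    using r(2)[of 0 t] that by (auto simp: algebra_simps)
  moreover have "continuous_on {0..T} (\<lambda>t. y 0 + integral {0..t} (\<lambda>s. vel s (y s) (r s)))"
    by (intro continuous_intros indefinite_integral_continuous_1 r)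
  ultimately show ?thesis by (metis (no_types, lifting) continuous_on_eq)
qed

text \<open>
  An upper bound for \<open>1 + norm (y s)\<close> along every trajectory \<open>y\<close> that passes through \<open>x0\<close>.
\<close>

definition bound :: "real^'n \<Rightarrow> real" where
  "bound x0 = 2 * (1 + norm x0) * exp (2 * K * T)"

lemma bound_pos: "0 < bound x0"
  unfolding bound_def by (intro mult_pos_pos) (auto intro: add_pos_nonneg)

text \<open>
  Let \<open>m\<close> be the maximum over \<open>s\<close> of \<open>(1 + norm (y s)) / W s\<close> for the weight \<open>W s = exp (2 * K * \<bar>s - t0\<bar>)\<close>,
  attained at \<open>\<tau>\<close>.  Integrating the growth condition from \<open>t0\<close> to \<open>\<tau>\<close> gives
  \<open>m * W \<tau> \<le> (1 + norm x0) + (m * W \<tau>) / 2\<close>, and the last term is absorbed by the left-hand side.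
\<close>

lemma traj_bound:
  assumes y: "traj t0 x0 y" and "t0 \<in> {0..T}" "s \<in> {0..T}"
  shows "1 + norm (y s) \<le> bound x0"
proof -
  define W where "W s = exp (2 * K * \<bar>s - t0\<bar>)" for s
  have W1: "1 \<le> W s" for s using K_pos by (simp add: W_def)
  have W: "W s > 0" for s by (simp add: W_def)
  have "continuous_on {0..T} (\<lambda>s. (1 + norm (y s)) / W s)"
    unfolding W_def by (intro continuous_intros traj_continuous[OF y]) auto
  then obtain \<tau> where \<tau>: "\<tau> \<in> {0..T}" "\<And>s. s \<in> {0..T} \<Longrightarrow> (1 + norm (y s)) / W s \<le> (1 + norm (y \<tau>)) / W \<tau>"
    using continuous_attains_sup[of "{0..T}"] T_pos by (force intro: less_imp_le)
  define m where "m = (1 + norm (y \<tau>)) / W \<tau>"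
  have m: "1 + norm (y s) \<le> m * W s" if "s \<in> {0..T}" for s
    using \<tau>(2)[OF that] W[of s] by (simp add: m_def divide_le_eq)
  have m0: "0 \<le> m" using W[of \<tau>] by (simp add: m_def)
  obtain r where r: "\<And>s. s \<in> {0..T} \<Longrightarrow> r s \<in> P \<times> Q" "(\<lambda>s. vel s (y s) (r s)) integrable_on {0..T}"
    "y t0 = x0"
    "\<And>s t. 0 \<le> s \<Longrightarrow> s \<le> t \<Longrightarrow> t \<le> T \<Longrightarrow> y t - y s = integral {s..t} (\<lambda>s. vel s (y s) (r s))"
    using y by (rule trajE) blast
  let ?F = "\<lambda>s. vel s (y s) (r s)"
  have sub: "{min t0 \<tau>..max t0 \<tau>} \<subseteq> {0..T}" using assms \<tau> by auto
  have "norm (y \<tau> - x0) = norm (integral {min t0 \<tau>..max t0 \<tau>} ?F)"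
    using r(3) r(4)[of t0 \<tau>] r(4)[of \<tau> t0] assms(2) \<tau>(1)
    by (cases "t0 \<le> \<tau>") (auto simp: min_def max_def norm_minus_commute)
  also have "\<dots> \<le> K * m * exp (2 * K * \<bar>\<tau> - t0\<bar>) / (2 * K)"
  proof (rule norm_integral_exp_weight_le)
    fix s assume "s \<in> {min t0 \<tau>..max t0 \<tau>}"
    then have s: "s \<in> {0..T}" using sub by blast
    have "norm (?F s) \<le> K * (1 + norm (y s))" using vel_growth r(1) s by blast
    also have "\<dots> \<le> K * (m * W s)" using m[OF s] K_pos by (intro mult_left_mono) auto
    finally show "norm (?F s) \<le> K * m * exp (2 * K * \<bar>s - t0\<bar>)" by (simp add: W_def)
  qed (use K_pos m0 in \<open>auto intro: integrable_on_subinterval[OF r(2) sub]\<close>)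
  also have "\<dots> = (m * W \<tau>) / 2" using K_pos by (simp add: W_def)
  finally have "norm (y \<tau>) \<le> norm x0 + (m * W \<tau>) / 2"
    using norm_triangle_ineq2[of "y \<tau>" x0] by linarith
  moreover have "m * W \<tau> = 1 + norm (y \<tau>)" using W[of \<tau>] by (simp add: m_def)
  moreover have "A \<le> 2 * (1 + b)" if "n \<le> b + A / 2" "A = 1 + n" for A b n :: real
    using that by (simp add: field_simps)
  ultimately have "m * W \<tau> \<le> 2 * (1 + norm x0)" by blast
  then have m2: "m \<le> 2 * (1 + norm x0)"
    using mult_left_mono[OF W1[of \<tau>] m0] by simp
  have "1 + norm (y s) \<le> m * W s" by (rule m[OF assms(3)])
  also have "\<dots> \<le> (2 * (1 + norm x0)) * exp (2 * K * T)"
  proof (rule mult_mono[OF m2])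
    show "W s \<le> exp (2 * K * T)"
      using K_pos assms(2,3) unfolding W_def by (auto intro!: mult_left_mono)
  qed (use W[of s] in auto)
  finally show ?thesis by (simp add: bound_def)
qed

lemma traj_lipschitz:
  assumes y: "traj t0 x0 y" and "t0 \<in> {0..T}" "s \<in> {0..T}" "t \<in> {0..T}"
  shows "norm (y t - y s) \<le> K * bound x0 * \<bar>t - s\<bar>"
proof -
  obtain r where r: "\<And>s. s \<in> {0..T} \<Longrightarrow> r s \<in> P \<times> Q" "(\<lambda>s. vel s (y s) (r s)) integrable_on {0..T}"
    "\<And>s t. 0 \<le> s \<Longrightarrow> s \<le> t \<Longrightarrow> t \<le> T \<Longrightarrow> y t - y s = integral {s..t} (\<lambda>s. vel s (y s) (r s))"
    using y by (rule trajE) blast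
  have *: "norm (y t - y s) \<le> K * bound x0 * (t - s)" if "0 \<le> s" "s \<le> t" "t \<le> T" for s t
    unfolding r(3)[OF that]
  proof (rule norm_integral_le_const)
    fix \<tau> assume "\<tau> \<in> {s..t}"
    then have \<tau>: "\<tau> \<in> {0..T}" using that by auto
    have "norm (vel \<tau> (y \<tau>) (r \<tau>)) \<le> K * (1 + norm (y \<tau>))" using vel_growth r(1) \<tau> by blast
    also have "\<dots> \<le> K * bound x0" using traj_bound[OF y assms(2) \<tau>] K_pos by (intro mult_left_mono) auto
    finally show "norm (vel \<tau> (y \<tau>) (r \<tau>)) \<le> K * bound x0" .
  qed (use that K_pos bound_pos[of x0] in \<open>auto intro: integrable_on_subinterval[OF r(2)]\<close>)
  show ?thesis
    using *[of s t] *[of t s] assms(3,4) by (cases "s \<le> t") (auto simp: norm_minus_commute)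
qed

text \<open>
  Uniform in the control because the controls range over a compact set.
\<close>

lemma vel_time_modulus:
  assumes "e > 0"
  obtains d where "d > 0"
    "\<And>s t x r. s \<in> {0..T} \<Longrightarrow> t \<in> {0..T} \<Longrightarrow> norm x \<le> R \<Longrightarrow> r \<in> P \<times> Q \<Longrightarrow> \<bar>s - t\<bar> < d
       \<Longrightarrow> norm (vel s x r - vel t x r) < e"
proof -
  let ?C = "{0..T} \<times> cball (0::real^'n) R \<times> (P \<times> Q)"
  have "compact ?C" by (intro compact_Times compact_controls compact_Icc compact_cball)
  moreover have "continuous_on ?C (\<lambda>(t, x, r). vel t x r)"
    by (rule continuous_on_subset[OF vel_continuous]) auto
  ultimately have "uniformly_continuous_on ?C (\<lambda>(t, x, r). vel t x r)"
    by (rule compact_uniformly_continuous[rotated])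
  then obtain d where d: "d > 0" "\<And>z z'. z \<in> ?C \<Longrightarrow> z' \<in> ?C \<Longrightarrow> dist z' z < d \<Longrightarrow>
      dist ((\<lambda>(t, x, r). vel t x r) z') ((\<lambda>(t, x, r). vel t x r) z) < e"
    using assms unfolding uniformly_continuous_on_def by metis
  show ?thesis
  proof (rule that[OF d(1)])
    fix s t :: real and x :: "real^'n" and r :: "'p \<times> 'q"
    assume *: "s \<in> {0..T}" "t \<in> {0..T}" "norm x \<le> R" "r \<in> P \<times> Q" "\<bar>s - t\<bar> < d"
    then show "norm (vel s x r - vel t x r) < e"
      using d(2)[of "(t, x, r)" "(s, x, r)"] by (auto simp: dist_Pair_Pair dist_norm)
  qed
qed

lemma vel_deviation:
  assumes "s \<in> {0..T}" "r \<in> P \<times> Q" "norm (vel s x r - vel t x r) \<le> e"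
  shows "norm (vel s y r - vel t x r) \<le> L * norm (y - x) + e"
  using vel_lipschitz[OF assms(1,2), of y x] assms(3)
    norm_triangle_ineq[of "vel s y r - vel s x r" "vel s x r - vel t x r"] by simp

lemma mem_Sol_iff:
  "y \<in> Sol T P Q f g t0 x0 \<longleftrightarrow> continuous_on {0..T} y \<and> y \<in> extensional {0..T} \<and>
     (\<forall>e>0. \<exists>x. traj t0 x0 x \<and> (\<forall>s\<in>{0..T}. dist (y s) (x s) \<le> e))"
proof -
  let ?M = "cfunspace (top_of_set {0..T}) (euclidean_metric :: (real^'n) metric)"
  interpret M: Metric_space "mspace ?M" "mdist ?M" by (rule Metric_space_mspace_mdist)
  have ms: "x \<in> mspace ?M \<longleftrightarrow> x \<in> extensional {0..T} \<and> continuous_on {0..T} x" for x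
    by (subst compactin_mspace_cfunspace) auto
  have S: "{restrict x {0..T} | x u v. u \<in> controls T P \<and> v \<in> controls T Q \<and> solution T f g t0 x0 u v x}
      = {restrict x {0..T} | x. traj t0 x0 x}" (is "?S = _")
    unfolding traj_def by blast
  have rm: "restrict x {0..T} \<in> mspace ?M" if "traj t0 x0 x" for x
    using continuous_on_eq[OF traj_continuous[OF that], of "restrict x {0..T}"] unfolding ms by simp
  have "y \<in> Sol T P Q f g t0 x0 \<longleftrightarrow> y \<in> M.mtopology closure_of ?S"
    unfolding Sol_def mtopology_of_def ..
  also have "\<dots> \<longleftrightarrow> y \<in> mspace ?M \<and> (\<forall>e>0. \<exists>x. traj t0 x0 x \<and> mdist ?M y (restrict x {0..T}) \<le> e)"
    unfolding M.metric_closure_of_alt S M.mcball_def using rm by (fastforce simp del: mspace_cfunspace)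
  also have "\<dots> \<longleftrightarrow> y \<in> mspace ?M \<and> (\<forall>e>0. \<exists>x. traj t0 x0 x \<and> (\<forall>s\<in>{0..T}. dist (y s) (x s) \<le> e))"
  proof -
    have "mdist ?M y (restrict x {0..T}) \<le> e \<longleftrightarrow> (\<forall>s\<in>{0..T}. dist (y s) (x s) \<le> e)"
      if "y \<in> mspace ?M" "traj t0 x0 x" for x e
      using cfunspace_mdist_le[OF that(1) rm[OF that(2)]] T_pos by simp
    then show ?thesis by blast
  qed
  finally show ?thesis unfolding ms by blast
qed

section \<open>Following convexified velocities with admissible controls\<close>

text \<open>
  This is the relaxation step.  The reference velocities \<open>a r\<close> are realised up to the error rate \<open>\<beta>\<close> by
  constant controls, and convex combinations of them by running through two admissible continuations
  in turn, with time shares equal to the weights.  Hence the velocities that can be realised on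
  every subinterval with error rate \<open>\<beta>\<close> form a convex set, and it contains the whole hull.  The
  deviation hypothesis has to speak of all trajectories with the value \<open>p\<close> at time \<open>t\<close>, since the
  trajectory is altered repeatedly after \<open>t\<close>.
\<close>

lemma steer_convexified_velocity:
  assumes t0: "0 \<le> t0" "t0 \<le> t" and b: "t \<le> b" "b \<le> T" and "0 \<le> \<beta>"
    and dev: "\<And>y s r. traj t0 x0 y \<Longrightarrow> y t = p \<Longrightarrow> s \<in> {t..b} \<Longrightarrow> r \<in> P \<times> Q \<Longrightarrow>
                norm (vel s (y s) r - a r) \<le> \<beta>"
    and w: "w \<in> convex hull (a ` (P \<times> Q))" and y: "traj t0 x0 y" "y t = p"
  obtains y' where "traj t0 x0 y'" "\<And>s. s \<le> t \<Longrightarrow> y' s = y s"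
    "norm (y' b - p - (b - t) *\<^sub>R w) \<le> (b - t) * \<beta>"
proof -
  define Good where "Good = {w. \<forall>c l y. t \<le> c \<and> 0 \<le> l \<and> c + l \<le> b \<and> traj t0 x0 y \<and> y t = p \<longrightarrow>
      (\<exists>y'. traj t0 x0 y' \<and> (\<forall>s\<le>c. y' s = y s) \<and> norm (y' (c + l) - y' c - l *\<^sub>R w) \<le> l * \<beta>)}"
  have "a ` (P \<times> Q) \<subseteq> Good"
  proof
    fix v assume "v \<in> a ` (P \<times> Q)"
    then obtain r where r: "r \<in> P \<times> Q" "v = a r" by blast
    show "v \<in> Good"
      unfolding Good_def
    proof clarify
      fix c l y assume *: "t \<le> c" "0 \<le> l" "c + l \<le> b" "traj t0 x0 y" "p = y t"
      obtain y' where y': "traj t0 x0 y'" "\<And>s. s \<le> c \<Longrightarrow> y' s = y s"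
        "\<And>s. s \<in> {c..T} \<Longrightarrow> y' s - y' c = integral {c..s} (\<lambda>s. vel s (y' s) r)"
        "(\<lambda>s. vel s (y' s) r) integrable_on {c..T}"
        using traj_switch[of t0 x0 y c r] * t0 b r by auto
      have int: "(\<lambda>s. vel s (y' s) r) integrable_on {c..c + l}"
        by (rule integrable_on_subinterval[OF y'(4)]) (use * b in auto)
      have "y' (c + l) - y' c - l *\<^sub>R v = integral {c..c + l} (\<lambda>s. vel s (y' s) r - a r)"
        using y'(3)[of "c + l"] * b int r(2) by (subst integral_diff) auto
      also have "norm \<dots> \<le> \<beta> * (c + l - c)"
      proof (rule norm_integral_le_const)
        fix s assume "s \<in> {c..c + l}"
        then show "norm (vel s (y' s) r - a r) \<le> \<beta>"
          using * y' r by (intro dev) auto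
      qed (use * \<open>0 \<le> \<beta>\<close> int in \<open>auto intro: integrable_diff\<close>)
      finally show "\<exists>y'. traj t0 x0 y' \<and> (\<forall>s\<le>c. y' s = y s) \<and>
          norm (y' (c + l) - y' c - l *\<^sub>R v) \<le> l * \<beta>"
        using y' by (auto simp: mult.commute)
    qed
  qed
  moreover have "convex Good"
  proof (rule convexI)
    fix v1 v2 and \<theta> \<mu> :: real
    assume v: "v1 \<in> Good" "v2 \<in> Good" and \<theta>: "0 \<le> \<theta>" "0 \<le> \<mu>" "\<theta> + \<mu> = 1"
    show "\<theta> *\<^sub>R v1 + \<mu> *\<^sub>R v2 \<in> Good"
      unfolding Good_def
    proof clarify
      fix c l y assume *: "t \<le> c" "0 \<le> l" "c + l \<le> b" "traj t0 x0 y" "p = y t"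
      \<comment> \<open>first \<open>v1\<close> for the time \<open>\<theta> * l\<close>, then \<open>v2\<close> for the time \<open>\<mu> * l\<close>\<close>
      have l: "l = \<theta> * l + \<mu> * l" using \<theta>(3) by (metis distrib_right mult_1)
      have l0: "0 \<le> \<theta> * l" "0 \<le> \<mu> * l" using * \<theta> by auto
      have l1: "c + \<theta> * l \<le> b" using l l0 * by linarith
      obtain y1 where y1: "traj t0 x0 y1" "\<forall>s\<le>c. y1 s = y s"
        "norm (y1 (c + \<theta> * l) - y1 c - (\<theta> * l) *\<^sub>R v1) \<le> (\<theta> * l) * \<beta>"
        using v(1) * l0(1) l1 unfolding Good_def by blast
      have y1t: "y1 t = p" using y1(2) * by simp
      have "t \<le> c + \<theta> * l \<and> 0 \<le> \<mu> * l \<and> (c + \<theta> * l) + \<mu> * l \<le> b \<and> traj t0 x0 y1 \<and> y1 t = p"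
        using * l l0 y1 y1t by linarith
      then obtain y2 where y2: "traj t0 x0 y2" "\<forall>s\<le>c + \<theta> * l. y2 s = y1 s"
        "norm (y2 ((c + \<theta> * l) + \<mu> * l) - y2 (c + \<theta> * l) - (\<mu> * l) *\<^sub>R v2) \<le> (\<mu> * l) * \<beta>"
        using v(2) unfolding Good_def by blast
      have cl: "(c + \<theta> * l) + \<mu> * l = c + l" using l by linarith
      have y2s: "y2 s = y s" if "s \<le> c" for s
        using that y1(2) y2(2) l0(1) by simp
      have "y2 (c + l) - y2 c - l *\<^sub>R (\<theta> *\<^sub>R v1 + \<mu> *\<^sub>R v2)
          = (y1 (c + \<theta> * l) - y1 c - (\<theta> * l) *\<^sub>R v1) + (y2 (c + l) - y2 (c + \<theta> * l) - (\<mu> * l) *\<^sub>R v2)"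
        using y2(2) y1(2) y2s by (simp add: algebra_simps)
      also have "norm \<dots> \<le> (\<theta> * l) * \<beta> + (\<mu> * l) * \<beta>"
        using y1(3) y2(3) cl by (intro norm_triangle_mono) auto
      also have "\<dots> = l * \<beta>" using l by (metis distrib_right)
      finally show "\<exists>y'. traj t0 x0 y' \<and> (\<forall>s\<le>c. y' s = y s) \<and>
          norm (y' (c + l) - y' c - l *\<^sub>R (\<theta> *\<^sub>R v1 + \<mu> *\<^sub>R v2)) \<le> l * \<beta>"
        using y2(1) y2s by blast
    qed
  qed
  ultimately have "w \<in> Good" using hull_minimal[of _ Good convex] w by blast
  moreover have "t \<le> t \<and> 0 \<le> b - t \<and> t + (b - t) \<le> b \<and> traj t0 x0 y \<and> y t = p"
    using y b by simp
  ultimately obtain y' where y': "traj t0 x0 y'" "\<forall>s\<le>t. y' s = y s"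
    "norm (y' (t + (b - t)) - y' t - (b - t) *\<^sub>R w) \<le> (b - t) * \<beta>"
    unfolding Good_def by blast
  then show ?thesis using that[of y'] y(2) by simp
qed

section \<open>Level-preserving motions from local steps\<close>

text \<open>
  The point \<open>(s, x')\<close> is reached from \<open>(t, x)\<close> by a step shorter than \<open>\<eta>\<close> whose velocity is admissible up to
  \<open>\<kappa>\<close> and along which \<open>c\<close> changes at a rate below \<open>\<kappa>\<close>.  All inequalities are strict, so that the same
  end point remains reachable from every nearby starting point.
\<close>

definition level_step :: "(real \<Rightarrow> real^'n \<Rightarrow> 'b::real_normed_vector) \<Rightarrow> real \<Rightarrow> real \<Rightarrow>
    real \<Rightarrow> real^'n \<Rightarrow> real \<Rightarrow> real^'n \<Rightarrow> bool" where
  "level_step c \<kappa> \<eta> t x s x' \<longleftrightarrow> t < s \<and> s < t + \<eta> \<and> s \<le> T \<and> norm (c s x' - c t x) < \<kappa> * (s - t) \<and>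
     (\<exists>w \<in> velocities P Q f g t x. norm (x' - x - (s - t) *\<^sub>R w) < \<kappa> * (s - t))"

text \<open>
  Lower semicontinuity of the set of convexified velocities, uniform over its elements.
\<close>

lemma velocities_perturb:
  assumes t: "t \<in> {0..T}" and "e > 0"
    and X: "(X \<longlongrightarrow> x) F" and \<tau>: "(\<tau> \<longlongrightarrow> t) F" "eventually (\<lambda>n. \<tau> n \<in> {0..T}) F"
  shows "eventually (\<lambda>n. \<forall>w\<in>velocities P Q f g t x. \<exists>w'\<in>velocities P Q f g (\<tau> n) (X n). norm (w - w') \<le> e) F"
proof -
  obtain d where "d > 0" and mod: "\<And>s t y r. s \<in> {0..T} \<Longrightarrow> t \<in> {0..T} \<Longrightarrow> norm y \<le> norm x \<Longrightarrow>
      r \<in> P \<times> Q \<Longrightarrow> \<bar>s - t\<bar> < d \<Longrightarrow> norm (vel s y r - vel t y r) < e / 2"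
    by (rule vel_time_modulus[OF half_gt_zero[OF \<open>e > 0\<close>], of "norm x"]) blast
  note d = \<open>d > 0\<close> mod[OF _ t order_refl]
  have "((\<lambda>n. L * norm (X n - x)) \<longlongrightarrow> L * norm (x - x)) F" by (intro tendsto_intros X)
  then have 1: "eventually (\<lambda>n. L * norm (X n - x) < e / 2) F"
    using \<open>e > 0\<close> by (intro order_tendstoD(2)) auto
  have 2: "eventually (\<lambda>n. \<bar>\<tau> n - t\<bar> < d) F"
    using tendstoD[OF \<tau>(1) d(1)] by (simp add: dist_real_def)
  show ?thesis
    using 1 2 \<tau>(2)
  proof eventually_elim
    case (elim n)
    have *: "norm (vel t x r - vel (\<tau> n) (X n) r) \<le> e" if "r \<in> P \<times> Q" for r
      using vel_deviation[of "\<tau> n" r x t "e / 2" "X n"] d(2)[of "\<tau> n" r] elim that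
      by (auto simp: norm_minus_commute)
    show ?case
      unfolding velocities_eq
      using convex_hull_image_perturb[of "P \<times> Q" "vel t x" "vel (\<tau> n) (X n)" e, OF *] by blast
  qed
qed

text \<open>
  Steps from nearby points can end in the same point \<open>(s, x')\<close>, so their lengths are locally bounded
  away from zero, and by compactness uniformly so.
\<close>

lemma uniform_level_step:
  assumes c: "continuous_on ({0..T} \<times> UNIV) (\<lambda>(t, x). c t x)"
    and S: "compact S" "S \<subseteq> {0..<T} \<times> UNIV"
    and "\<kappa> > 0"
    and st: "\<And>t x. (t, x) \<in> S \<Longrightarrow> \<exists>s x'. level_step c \<kappa> \<eta> t x s x'"
  obtains m where "m > 0" "\<And>t x. (t, x) \<in> S \<Longrightarrow> \<exists>s x'. t + m \<le> s \<and> level_step c \<kappa> \<eta> t x s x'"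
proof (rule ccontr)
  assume "\<not> thesis"
  note found = that
  have neg: "\<exists>t x. (t, x) \<in> S \<and> (\<forall>s x'. t + m \<le> s \<longrightarrow> \<not> level_step c \<kappa> \<eta> t x s x')" if "m > 0" for m
    using found[OF that] \<open>\<not> thesis\<close> by blast
  have "\<exists>z. z \<in> S \<and> (\<forall>s x'. fst z + inverse (real (Suc n)) \<le> s \<longrightarrow> \<not> level_step c \<kappa> \<eta> (fst z) (snd z) s x')" for n
    using neg[of "inverse (real (Suc n))"] by auto
  then obtain z where z: "\<And>n. z n \<in> S"
    "\<And>n s x'. fst (z n) + inverse (real (Suc n)) \<le> s \<Longrightarrow> \<not> level_step c \<kappa> \<eta> (fst (z n)) (snd (z n)) s x'"
    by metis
  obtain l k where l: "l \<in> S" and k: "strict_mono k" and lim: "(z \<circ> k) \<longlonglongrightarrow> l"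
    using S(1) z(1) unfolding compact_def by metis
  define t x where "t = fst l" and "x = snd l"
  define \<tau> X where "\<tau> n = fst (z (k n))" and "X n = snd (z (k n))" for n
  have \<tau>X: "\<tau> n \<in> {0..<T}" for n using z(1)[of "k n"] S(2) by (auto simp: \<tau>_def)
  have \<tau>: "\<tau> \<longlonglongrightarrow> t" using tendsto_fst[OF lim] by (simp add: \<tau>_def[abs_def] t_def o_def)
  have X: "X \<longlonglongrightarrow> x" using tendsto_snd[OF lim] by (simp add: X_def[abs_def] x_def o_def)
  have t: "t \<in> {0..<T}" using l S(2) by (auto simp: t_def)
  obtain s x' where "level_step c \<kappa> \<eta> t x s x'" using st[of t x] l by (auto simp: t_def x_def)
  then obtain w where s: "t < s" "s < t + \<eta>" "s \<le> T" and cs: "norm (c s x' - c t x) < \<kappa> * (s - t)"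
    and w: "w \<in> velocities P Q f g t x" "norm (x' - x - (s - t) *\<^sub>R w) < \<kappa> * (s - t)"
    unfolding level_step_def by blast
  \<comment> \<open>half of the slack in the velocity estimate, to be spent on replacing \<open>w\<close> by a nearby velocity\<close>
  define e where "e = (\<kappa> * (s - t) - norm (x' - x - (s - t) *\<^sub>R w)) / (2 * (s - t))"
  have e: "e > 0" using w(2) s(1) by (simp add: e_def)
  have e2: "norm (x' - x - (s - t) *\<^sub>R w) + (s - t) * e < \<kappa> * (s - t)"
  proof -
    have "(s - t) * e = (\<kappa> * (s - t) - norm (x' - x - (s - t) *\<^sub>R w)) / 2"
      using s(1) unfolding e_def by (simp add: field_simps)
    moreover have "N + (X - N) / 2 < X" if "N < X" for N X :: real
      using that by (simp add: field_simps)
    ultimately show ?thesis using w(2) by metis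
  qed
  have "(\<lambda>n. (\<lambda>(t, x). c t x) (\<tau> n, X n)) \<longlonglongrightarrow> (\<lambda>(t, x). c t x) (t, x)"
    by (rule continuous_on_tendsto_compose[OF c tendsto_Pair[OF \<tau> X]])
       (use t \<tau>X in \<open>auto simp: less_imp_le\<close>)
  then have cl: "(\<lambda>n. c (\<tau> n) (X n)) \<longlonglongrightarrow> c t x" by simp
  have "(\<lambda>n. \<kappa> * (s - \<tau> n) - norm (c s x' - c (\<tau> n) (X n))) \<longlonglongrightarrow> \<kappa> * (s - t) - norm (c s x' - c t x)"
    by (intro tendsto_intros \<tau> cl)
  then have ev1: "eventually (\<lambda>n. 0 < \<kappa> * (s - \<tau> n) - norm (c s x' - c (\<tau> n) (X n))) sequentially"
    using cs by (intro order_tendstoD(1)) auto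
  have "(\<lambda>n. \<kappa> * (s - \<tau> n) - (norm (x' - X n - (s - \<tau> n) *\<^sub>R w) + (s - \<tau> n) * e))
      \<longlonglongrightarrow> \<kappa> * (s - t) - (norm (x' - x - (s - t) *\<^sub>R w) + (s - t) * e)"
    by (intro tendsto_intros \<tau> X)
  then have ev2: "eventually (\<lambda>n. 0 < \<kappa> * (s - \<tau> n) - (norm (x' - X n - (s - \<tau> n) *\<^sub>R w) + (s - \<tau> n) * e)) sequentially"
    using e2 by (intro order_tendstoD(1)) auto
  have ev3: "eventually (\<lambda>n. \<exists>w'\<in>velocities P Q f g (\<tau> n) (X n). norm (w - w') \<le> e) sequentially"
    using velocities_perturb[OF _ e X \<tau>] t \<tau>X w(1) by (force elim: eventually_mono simp: less_imp_le)
  have ev4: "eventually (\<lambda>n. \<tau> n < s) sequentially" using order_tendstoD(2)[OF \<tau>] s by auto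
  have ev5: "eventually (\<lambda>n. s - \<eta> < \<tau> n) sequentially" using order_tendstoD(1)[OF \<tau>] s by auto
  have "(\<lambda>n. inverse (real (Suc (k n)))) \<longlonglongrightarrow> 0"
    using LIMSEQ_subseq_LIMSEQ[OF LIMSEQ_inverse_real_of_nat k] by (simp add: o_def)
  then have "(\<lambda>n. \<tau> n + inverse (real (Suc (k n)))) \<longlonglongrightarrow> t + 0" by (intro tendsto_intros \<tau>)
  then have ev6: "eventually (\<lambda>n. \<tau> n + inverse (real (Suc (k n))) < s) sequentially"
    using s by (intro order_tendstoD(2)) auto
  have "eventually (\<lambda>n. False) sequentially"
    using ev1 ev2 ev3 ev4 ev5 ev6
  proof eventually_elim
    case (elim n)
    then obtain w' where w': "w' \<in> velocities P Q f g (\<tau> n) (X n)" "norm (w - w') \<le> e" by blast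
    have "x' - X n - (s - \<tau> n) *\<^sub>R w' = (x' - X n - (s - \<tau> n) *\<^sub>R w) + (s - \<tau> n) *\<^sub>R (w - w')"
      by (simp add: algebra_simps)
    also have "norm \<dots> \<le> norm (x' - X n - (s - \<tau> n) *\<^sub>R w) + (s - \<tau> n) * e"
      using elim w'(2) by (intro norm_triangle_mono) (auto intro: mult_left_mono)
    finally have "level_step c \<kappa> \<eta> (\<tau> n) (X n) s x'"
      unfolding level_step_def using elim s w'(1) by force
    then show False using z(2)[of "k n" s x'] elim by (simp add: \<tau>_def X_def)
  qed
  then show False by simp
qed

text \<open>
  The steps are chained to a polygon \<open>x\<close>, and a trajectory \<open>y\<close> is steered along it.  The function \<open>c\<close>
  is controlled only at the vertices of the polygon, because it need not be Lipschitz and errors in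
  the state would otherwise accumulate in its values without control.  The distance between \<open>y\<close> and the
  vertices grows by the factor \<open>1 + L * h\<close> and an error \<open>A * \<kappa> * h\<close> in a step of length \<open>h\<close>, so that
  \<open>A * \<kappa> * (t - t0) * exp (L * (t - t0))\<close> bounds it.  As step lengths are bounded below as long as
  \<open>t \<le> T - \<kappa>\<close>, finitely many steps lead beyond \<open>T - \<kappa>\<close>; the short rest of the interval is covered by the
  speed bound \<open>M\<close>.
\<close>

lemma approximate_level_motion:
  assumes c: "continuous_on ({0..T} \<times> UNIV) (\<lambda>(t, x). c t x)"
    and st: "\<And>t x \<kappa> \<eta>. t \<in> {0..<T} \<Longrightarrow> \<kappa> > 0 \<Longrightarrow> \<eta> > 0 \<Longrightarrow> \<exists>s x'. level_step c \<kappa> \<eta> t x s x'"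
    and t0: "t0 \<in> {0..T}" and "\<epsilon> > 0"
  obtains y where "traj t0 x0 y"
    "\<And>s. s \<in> {t0..T} \<Longrightarrow> \<exists>s'\<in>{0..T}. \<exists>x'. \<bar>s' - s\<bar> \<le> \<epsilon> \<and> norm (x' - y s) \<le> \<epsilon> \<and> norm (c s' x' - c t0 x0) \<le> \<epsilon>"
proof -
  define M where "M = K * bound x0"
  define A where "A = L * M + 2"
  define D where "D = A * T * exp (L * T)"
  \<comment> \<open>small enough for every requirement collected in \<open>small1\<close> below\<close>
  define \<kappa> where "\<kappa> = min \<epsilon> 1 / (1 + T + D + M)"
  have M: "M > 0" using K_pos bound_pos by (simp add: M_def)
  have A: "A > 0" using L_pos M by (simp add: A_def add_pos_pos)
  have D: "D > 0" using A T_pos by (simp add: D_def)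
  have \<kappa>: "\<kappa> > 0" using \<open>\<epsilon> > 0\<close> T_pos D M by (simp add: \<kappa>_def)
  have small: "\<kappa> * q \<le> \<epsilon>" "\<kappa> * q \<le> 1" if "q \<le> 1 + T + D + M" for q
  proof -
    have "\<kappa> * q \<le> \<kappa> * (1 + T + D + M)" using that \<kappa> by (intro mult_left_mono) auto
    also have "\<dots> = min \<epsilon> 1" using T_pos D M by (simp add: \<kappa>_def)
    finally show "\<kappa> * q \<le> \<epsilon>" "\<kappa> * q \<le> 1" by auto
  qed
  have small1: "\<kappa> \<le> \<epsilon>" "\<kappa> * T \<le> \<epsilon>" "\<kappa> * D \<le> 1" "\<kappa> * D + M * \<kappa> \<le> \<epsilon>"
    using small(1)[of 1] small(1)[of T] small(2)[of D] small(1)[of "D + M"] T_pos D M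
    by (auto simp: algebra_simps)
  obtain d where d: "d > 0"
    "\<And>s t x r. s \<in> {0..T} \<Longrightarrow> t \<in> {0..T} \<Longrightarrow> norm x \<le> bound x0 \<Longrightarrow> r \<in> P \<times> Q \<Longrightarrow> \<bar>s - t\<bar> < d
       \<Longrightarrow> norm (vel s x r - vel t x r) < \<kappa>"
    using vel_time_modulus[OF \<kappa>] by metis
  define \<eta> where "\<eta> = min \<kappa> d"
  have \<eta>: "\<eta> > 0" using \<kappa> d by (simp add: \<eta>_def)
  let ?S = "{0..T - \<kappa>} \<times> cball (0::real^'n) (bound x0)"
  obtain m where m: "m > 0" "\<And>t x. (t, x) \<in> ?S \<Longrightarrow> \<exists>s x'. t + m \<le> s \<and> level_step c \<kappa> \<eta> t x s x'"
  proof (rule uniform_level_step[OF c, of ?S \<kappa> \<eta>])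
    show "compact ?S" by (intro compact_Times compact_Icc compact_cball)
    show "\<exists>s x'. level_step c \<kappa> \<eta> t x s x'" if "(t, x) \<in> ?S" for t x
      using that \<kappa> \<eta> by (intro st) auto
  qed (use \<kappa> in auto)
  define E where "E t = A * \<kappa> * (t - t0) * exp (L * (t - t0))" for t
  have E0: "0 \<le> E t" if "t0 \<le> t" for t using that A \<kappa> by (simp add: E_def)
  have ED: "E t \<le> \<kappa> * D" if "t \<in> {t0..T}" for t
  proof -
    have "A * \<kappa> * ((t - t0) * exp (L * (t - t0))) \<le> A * \<kappa> * (T * exp (L * T))"
      using that t0 A \<kappa> L_pos T_pos by (intro mult_left_mono mult_mono) auto
    then show ?thesis by (simp add: E_def D_def algebra_simps)
  qed
  \<comment> \<open>one step of the error recursion stays below the exponential bound\<close>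
  have Estep: "E t * (1 + L * h) + A * \<kappa> * h \<le> E (t + h)" if "t0 \<le> t" "0 \<le> h" for t h
  proof -
    have A0: "0 \<le> A * \<kappa>" using A \<kappa> by simp
    have "1 + L * h \<le> exp (L * h)" by (rule exp_ge_add_one_self)
    then have 1: "E t * (1 + L * h) \<le> E t * exp (L * h)" using E0[OF that(1)] by (rule mult_left_mono)
    have 2: "A * \<kappa> * h * 1 \<le> A * \<kappa> * h * exp (L * (t + h - t0))"
      using A0 that L_pos by (intro mult_left_mono) auto
    have "exp (L * (t - t0)) * exp (L * h) = exp (L * (t + h - t0))"
      by (simp add: algebra_simps flip: exp_add)
    then have "E t * exp (L * h) = A * \<kappa> * (t - t0) * exp (L * (t + h - t0))"
      by (simp add: E_def mult.assoc)
    then have "E t * exp (L * h) + A * \<kappa> * h * exp (L * (t + h - t0)) = E (t + h)"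
      by (simp add: E_def algebra_simps)
    with 1 2 show ?thesis by simp
  qed
  \<comment> \<open>weaker than \<open>c s (y s)\<close> being close to \<open>c t0 x0\<close>, but equivalent to it in the limit \<open>\<epsilon> \<rightarrow> 0\<close>\<close>
  define near where "near y s \<longleftrightarrow> (\<exists>s'\<in>{0..T}. \<exists>x'. \<bar>s' - s\<bar> \<le> \<epsilon> \<and> norm (x' - y s) \<le> \<epsilon> \<and>
      norm (c s' x' - c t0 x0) \<le> \<epsilon>)" for y s
  define Inv where "Inv t y x \<longleftrightarrow> t \<in> {t0..T} \<and> traj t0 x0 y \<and> norm (y t - x) \<le> E t \<and>
      norm (c t x - c t0 x0) \<le> \<kappa> * (t - t0) \<and> (\<forall>s\<in>{t0..t}. near y s)" for t y x
  \<comment> \<open>serves both for the interior of a step and for the rest of the interval after the last step\<close>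
  have near_tail: "near y' s"
    if I: "Inv t y x" and y': "traj t0 x0 y'" "y' t = y t" and s: "s \<in> {t..T}" "s \<le> t + \<kappa>" for t y x y' s
  proof -
    have t: "t \<in> {t0..T}" and yx: "norm (y t - x) \<le> E t" and cx: "norm (c t x - c t0 x0) \<le> \<kappa> * (t - t0)"
      using I by (auto simp: Inv_def)
    have "norm (y' s - y' t) \<le> M * \<bar>s - t\<bar>"
      unfolding M_def using t t0 s by (intro traj_lipschitz[OF y'(1)]) auto
    also have "\<dots> \<le> M * \<kappa>" using s M by (intro mult_left_mono) auto
    finally have "norm (x - y' s) \<le> \<kappa> * D + M * \<kappa>"
      using yx ED[OF t] y'(2) norm_triangle_ineq4[of "x - y t" "y' s - y t"] by (simp add: norm_minus_commute)
    moreover have "\<kappa> * (t - t0) \<le> \<kappa> * T" using t t0 \<kappa> by (intro mult_left_mono) auto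
    ultimately show ?thesis
      unfolding near_def using t t0 s cx small1 by (intro bexI[of _ t] exI[of _ x]) auto
  qed
  have advance: "\<exists>t' y' x'. t + m \<le> t' \<and> Inv t' y' x'" if I: "Inv t y x" and tT: "t \<le> T - \<kappa>" for t y x
  proof -
    have t: "t \<in> {t0..T}" and y: "traj t0 x0 y" and yx: "norm (y t - x) \<le> E t"
      and cx: "norm (c t x - c t0 x0) \<le> \<kappa> * (t - t0)" and hist: "\<And>s. s \<in> {t0..t} \<Longrightarrow> near y s"
      using I by (auto simp: Inv_def)
    have t': "t \<in> {0..T}" using t t0 by auto
    have xb: "norm x \<le> bound x0"
      using traj_bound[OF y t0 t'] yx ED[OF t] small1(3) norm_triangle_ineq2[of x "y t"]
      by (simp add: norm_minus_commute)
    then obtain s x' where ts: "t + m \<le> s" and "level_step c \<kappa> \<eta> t x s x'"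
      using m(2)[of t x] t' tT by auto
    then obtain w where s: "t < s" "s < t + \<eta>" "s \<le> T" and cs: "norm (c s x' - c t x) < \<kappa> * (s - t)"
      and w: "w \<in> velocities P Q f g t x" "norm (x' - x - (s - t) *\<^sub>R w) < \<kappa> * (s - t)"
      unfolding level_step_def by blast
    have s\<kappa>: "s - t \<le> \<kappa>" "s - t < d" using s(2) by (auto simp: \<eta>_def)
    \<comment> \<open>deviation of velocities: \<open>L\<close> times the distance from the vertex, plus the time modulus\<close>
    define \<beta> where "\<beta> = L * (E t + M * (s - t)) + \<kappa>"
    have dev: "norm (vel \<sigma> (z \<sigma>) r - vel t x r) \<le> \<beta>"
      if z: "traj t0 x0 z" "z t = y t" and \<sigma>: "\<sigma> \<in> {t..s}" and r: "r \<in> P \<times> Q" for z \<sigma> r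
    proof -
      have \<sigma>': "\<sigma> \<in> {0..T}" using \<sigma> s t' by auto
      have "norm (z \<sigma> - z t) \<le> M * \<bar>\<sigma> - t\<bar>"
        unfolding M_def by (rule traj_lipschitz[OF z(1) t0 t' \<sigma>'])
      also have "\<dots> \<le> M * (s - t)" using \<sigma> M by (intro mult_left_mono) auto
      finally have "norm (z \<sigma> - x) \<le> E t + M * (s - t)"
        using yx z(2) norm_triangle_ineq[of "z \<sigma> - y t" "y t - x"] by simp
      then have "L * norm (z \<sigma> - x) \<le> L * (E t + M * (s - t))" using L_pos by (intro mult_left_mono) auto
      moreover have "norm (vel \<sigma> (z \<sigma>) r - vel t x r) \<le> L * norm (z \<sigma> - x) + \<kappa>"
        using d(2)[OF \<sigma>' t' xb r] \<sigma> s\<kappa>(2) by (intro vel_deviation[OF \<sigma>' r]) auto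
      ultimately show ?thesis by (simp add: \<beta>_def)
    qed
    have "0 \<le> \<beta>" using E0[of t] t L_pos M s \<kappa> by (simp add: \<beta>_def)
    then obtain y' where y': "traj t0 x0 y'" "\<And>s. s \<le> t \<Longrightarrow> y' s = y s"
      "norm (y' s - y t - (s - t) *\<^sub>R w) \<le> (s - t) * \<beta>"
      using steer_convexified_velocity[of t0 t s \<beta> x0 "y t" "vel t x" w y]
        dev w(1) y s t t0 by (auto simp: velocities_eq)
    have "y' s - x' = (y' s - y t - (s - t) *\<^sub>R w) + ((y t - x) - (x' - x - (s - t) *\<^sub>R w))"
      by (simp add: algebra_simps)
    also have "norm \<dots> \<le> (s - t) * \<beta> + (E t + \<kappa> * (s - t))"
      using y'(3) yx w(2) norm_triangle_ineq4[of "y t - x" "x' - x - (s - t) *\<^sub>R w"]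
      by (intro norm_triangle_mono) auto
    also have "\<dots> = E t * (1 + L * (s - t)) + (L * M * (s - t) + 2 * \<kappa>) * (s - t)"
      by (simp add: \<beta>_def algebra_simps)
    also have "\<dots> \<le> E t * (1 + L * (s - t)) + (L * M * \<kappa> + 2 * \<kappa>) * (s - t)"
      using s s\<kappa> L_pos M by (intro add_left_mono mult_right_mono add_right_mono mult_left_mono) auto
    also have "\<dots> = E t * (1 + L * (s - t)) + A * \<kappa> * (s - t)" by (simp add: A_def algebra_simps)
    also have "\<dots> \<le> E s" using Estep[of t "s - t"] t s by simp
    finally have ys: "norm (y' s - x') \<le> E s" .
    have "norm (c s x' - c t0 x0) \<le> \<kappa> * (s - t0)"
      using cs cx norm_triangle_ineq[of "c s x' - c t x" "c t x - c t0 x0"] by (simp add: algebra_simps)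
    moreover have "near y' \<sigma>" if "\<sigma> \<in> {t0..s}" for \<sigma>
    proof (cases "\<sigma> \<le> t")
      case True
      then show ?thesis using hist[of \<sigma>] y'(2) that by (simp add: near_def)
    next
      case False
      then show ?thesis using near_tail[OF I y'(1)] y'(2) that s s\<kappa> by simp
    qed
    ultimately have "Inv s y' x'" using ys y'(1) s t by (auto simp: Inv_def)
    with ts show ?thesis by blast
  qed
  have "\<exists>t y x. Inv t y x \<and> T - \<kappa> < t"
  proof (rule ccontr)
    assume "\<nexists>t y x. Inv t y x \<and> T - \<kappa> < t"
    then have stay: "t \<le> T - \<kappa>" if "Inv t y x" for t y x using that by force
    have "\<exists>t y x. Inv t y x \<and> t0 + real n * m \<le> t" for n
    proof (induction n)
      case 0
      obtain y where y: "traj t0 x0 y" using traj_exists[OF t0] .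
      have "near y t0"
        unfolding near_def using traj_start[OF y] t0 \<open>\<epsilon> > 0\<close> by (intro bexI[of _ t0] exI[of _ x0]) auto
      then have "Inv t0 y x0" using y t0 traj_start[OF y] by (auto simp: Inv_def E_def)
      then show ?case by auto
    next
      case (Suc n)
      then obtain t y x where *: "Inv t y x" "t0 + real n * m \<le> t" by blast
      then obtain t' y' x' where "t + m \<le> t'" "Inv t' y' x'" using advance stay by blast
      with * show ?case by (intro exI[of _ t'] exI[of _ y'] exI[of _ x']) (auto simp: algebra_simps)
    qed
    moreover obtain n :: nat where "T / m < real n" using reals_Archimedean2 by blast
    then have "T < real n * m" using m(1) by (simp add: divide_less_eq)
    ultimately obtain t y x where "Inv t y x" "t0 + real n * m \<le> t" by blast
    then show False using \<open>T < real n * m\<close> t0 by (simp add: Inv_def)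
  qed
  then obtain t y x where I: "Inv t y x" and t: "T - \<kappa> < t" by blast
  show ?thesis
  proof (rule that)
    show "traj t0 x0 y" using I by (simp add: Inv_def)
    fix s assume s: "s \<in> {t0..T}"
    have "near y s"
    proof (cases "s \<le> t")
      case True
      then show ?thesis using I s by (simp add: Inv_def)
    next
      case False
      then show ?thesis using near_tail[OF I] I s t by (simp add: Inv_def)
    qed
    then show "\<exists>s'\<in>{0..T}. \<exists>x'. \<bar>s' - s\<bar> \<le> \<epsilon> \<and> norm (x' - y s) \<le> \<epsilon> \<and> norm (c s' x' - c t0 x0) \<le> \<epsilon>"
      by (simp add: near_def)
  qed
qed

text \<open>
  Trajectories through one point are uniformly bounded and have a common Lipschitz constant.  A uniform
  limit of approximate motions exists by Arzela-Ascoli and belongs to the closure \<open>Sol\<close>; continuity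
  of \<open>c\<close> turns the approximate level equation into an exact one.
\<close>

lemma level_motion:
  assumes c: "continuous_on ({0..T} \<times> UNIV) (\<lambda>(t, x). c t x)"
    and st: "\<And>t x \<kappa> \<eta>. t \<in> {0..<T} \<Longrightarrow> \<kappa> > 0 \<Longrightarrow> \<eta> > 0 \<Longrightarrow> \<exists>s x'. level_step c \<kappa> \<eta> t x s x'"
    and t0: "t0 \<in> {0..T}"
  obtains y where "y \<in> Sol T P Q f g t0 x0" "\<And>t. t \<in> {t0..T} \<Longrightarrow> c t (y t) = c t0 x0"
proof -
  define \<epsilon> where "\<epsilon> n = inverse (real (Suc n))" for n
  have \<epsilon>: "\<epsilon> n > 0" for n by (simp add: \<epsilon>_def)
  have \<epsilon>0: "\<epsilon> \<longlonglongrightarrow> 0" unfolding \<epsilon>_def by (rule LIMSEQ_inverse_real_of_nat)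
  have "\<exists>y. traj t0 x0 y \<and> (\<forall>s\<in>{t0..T}. \<exists>s'\<in>{0..T}. \<exists>x'. \<bar>s' - s\<bar> \<le> \<epsilon> n \<and> norm (x' - y s) \<le> \<epsilon> n \<and>
      norm (c s' x' - c t0 x0) \<le> \<epsilon> n)" for n
    by (rule approximate_level_motion[OF c _ t0 \<epsilon>[of n], of x0]) (use st in blast)+
  then obtain Y where Y: "\<And>n. traj t0 x0 (Y n)" and near: "\<And>n s. s \<in> {t0..T} \<Longrightarrow>
      \<exists>s'\<in>{0..T}. \<exists>x'. \<bar>s' - s\<bar> \<le> \<epsilon> n \<and> norm (x' - Y n s) \<le> \<epsilon> n \<and> norm (c s' x' - c t0 x0) \<le> \<epsilon> n"
    by metis
  define M where "M = K * bound x0"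
  have M: "M > 0" using K_pos bound_pos by (simp add: M_def)
  obtain h k where h: "continuous_on {0..T} h" and k: "strict_mono (k :: nat \<Rightarrow> nat)"
    and lim: "\<And>e. 0 < e \<Longrightarrow> \<exists>N. \<forall>n x. n \<ge> N \<and> x \<in> {0..T} \<longrightarrow> norm (Y (k n) x - h x) < e"
  proof (rule Arzela_Ascoli[of "{0..T}" Y "bound x0"])
    show "norm (Y n x) \<le> bound x0" if "x \<in> {0..T}" for n x
      using traj_bound[OF Y t0 that, of n] by simp
    show "\<exists>d>0. \<forall>n y. y \<in> {0..T} \<and> norm (x - y) < d \<longrightarrow> norm (Y n x - Y n y) < e"
      if "x \<in> {0..T}" "0 < e" for x e
    proof (intro exI[of _ "e / M"] conjI allI impI)
      fix n y assume *: "y \<in> {0..T} \<and> norm (x - y) < e / M"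
      then have "norm (Y n x - Y n y) \<le> M * \<bar>x - y\<bar>"
        unfolding M_def using that by (intro traj_lipschitz[OF Y t0]) auto
      also have "\<dots> < e" using * M by (simp add: field_simps)
      finally show "norm (Y n x - Y n y) < e" .
    qed (use that M in auto)
  qed (use that in auto)
  let ?y = "restrict h {0..T}"
  show ?thesis
  proof (rule that[of ?y])
    have "\<exists>x. traj t0 x0 x \<and> (\<forall>s\<in>{0..T}. dist (?y s) (x s) \<le> e)" if e: "e > 0" for e
    proof -
      obtain N where "\<forall>n x. n \<ge> N \<and> x \<in> {0..T} \<longrightarrow> norm (Y (k n) x - h x) < e" using lim[OF e] by blast
      then show ?thesis using Y
        by (intro exI[of _ "Y (k N)"]) (force simp: dist_norm norm_minus_commute intro: less_imp_le)
    qed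
    moreover have "continuous_on {0..T} ?y" using continuous_on_eq[OF h, of ?y] by simp
    ultimately show "?y \<in> Sol T P Q f g t0 x0" unfolding mem_Sol_iff by simp
  next
    fix t assume t: "t \<in> {t0..T}"
    have \<epsilon>k: "(\<lambda>n. \<epsilon> (k n)) \<longlonglongrightarrow> 0" using LIMSEQ_subseq_LIMSEQ[OF \<epsilon>0 k] by (simp add: o_def)
    have "\<exists>s x. s \<in> {0..T} \<and> \<bar>s - t\<bar> \<le> \<epsilon> (k n) \<and> norm (x - Y (k n) t) \<le> \<epsilon> (k n) \<and>
        norm (c s x - c t0 x0) \<le> \<epsilon> (k n)" for n
      using near[OF t, of "k n"] by blast
    then obtain s x where sx: "\<And>n. s n \<in> {0..T}" "\<And>n. \<bar>s n - t\<bar> \<le> \<epsilon> (k n)" "\<And>n. norm (x n - Y (k n) t) \<le> \<epsilon> (k n)"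
      "\<And>n. norm (c (s n) (x n) - c t0 x0) \<le> \<epsilon> (k n)"
      by metis
    have "(\<lambda>n. s n - t) \<longlonglongrightarrow> 0" by (rule Lim_null_comparison[OF _ \<epsilon>k]) (use sx in auto)
    then have s: "s \<longlonglongrightarrow> t" by (simp add: LIM_zero_iff)
    have "(\<lambda>n. x n - Y (k n) t) \<longlonglongrightarrow> 0" by (rule Lim_null_comparison[OF _ \<epsilon>k]) (use sx in auto)
    moreover have "(\<lambda>n. Y (k n) t) \<longlonglongrightarrow> h t"
      unfolding LIMSEQ_iff
    proof (intro allI impI)
      fix e :: real assume "0 < e"
      from lim[OF this] show "\<exists>N. \<forall>n\<ge>N. norm (Y (k n) t - h t) < e"
        by (rule ex_forward) (use t t0 in auto)
    qed
    ultimately have "(\<lambda>n. x n - Y (k n) t + Y (k n) t) \<longlonglongrightarrow> 0 + h t" by (rule tendsto_add)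
    then have x: "x \<longlonglongrightarrow> h t" by simp
    have "(\<lambda>n. (\<lambda>(t, x). c t x) (s n, x n)) \<longlonglongrightarrow> (\<lambda>(t, x). c t x) (t, h t)"
      by (rule continuous_on_tendsto_compose[OF c tendsto_Pair[OF s x]]) (use t t0 sx in auto)
    moreover have "(\<lambda>n. c (s n) (x n) - c t0 x0) \<longlonglongrightarrow> 0"
      by (rule Lim_null_comparison[OF _ \<epsilon>k]) (use sx in auto)
    then have "(\<lambda>n. c (s n) (x n)) \<longlonglongrightarrow> c t0 x0" by (simp add: LIM_zero_iff)
    ultimately have "c t (h t) = c t0 x0" using LIMSEQ_unique by fastforce
    then show "c t (?y t) = c t0 x0" using t t0 by simp
  qed
qed

section \<open>Initial velocities of motions\<close>

text \<open>
  A difference quotient of a trajectory is a mean of velocities that are all close to velocities at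
  \<open>(t0, x0)\<close>, hence it lies in a closed convex neighbourhood of the convexified velocities.  The size \<open>d\<close> of
  the time interval does not depend on the trajectory, so the conclusion survives the passage to the
  closure.
\<close>

lemma Sol_difference_quotient:
  assumes t0: "t0 \<in> {0..T}" and "e > 0"
  obtains d where "d > 0"
    "\<And>\<delta> y. 0 < \<delta> \<Longrightarrow> \<delta> < d \<Longrightarrow> t0 + \<delta> \<le> T \<Longrightarrow> y \<in> Sol T P Q f g t0 x0 \<Longrightarrow>
       \<exists>w\<in>velocities P Q f g t0 x0. norm ((y (t0 + \<delta>) - x0) /\<^sub>R \<delta> - w) \<le> e"
proof -
  let ?V = "velocities P Q f g t0 x0"
  define C where "C = (\<Union>w\<in>?V. \<Union>b\<in>cball 0 e. {w + b})"
  have "compact ?V" using t0 by (rule compact_velocities)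
  then have C: "closed C" "convex C"
    unfolding C_def
    by (auto intro!: compact_imp_closed compact_sums' convex_sums simp: velocities_eq convex_convex_hull)
  have memC: "x \<in> C \<longleftrightarrow> (\<exists>w\<in>?V. norm (x - w) \<le> e)" for x
  proof
    assume "\<exists>w\<in>?V. norm (x - w) \<le> e"
    then obtain w where "w \<in> ?V" "norm (x - w) \<le> e" by blast
    moreover have "x = w + (x - w)" by simp
    ultimately show "x \<in> C" unfolding C_def by (metis (no_types, lifting) UN_I mem_cball_0 singletonI)
  next
    assume "x \<in> C"
    then obtain w b where "w \<in> ?V" "norm b \<le> e" "x = w + b" by (auto simp: C_def)
    then show "\<exists>w\<in>?V. norm (x - w) \<le> e" by (intro bexI[of _ w]) auto
  qed
  obtain d where "d > 0" and mod: "\<And>s t y r. s \<in> {0..T} \<Longrightarrow> t \<in> {0..T} \<Longrightarrow> norm y \<le> norm x0 \<Longrightarrow>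
      r \<in> P \<times> Q \<Longrightarrow> \<bar>s - t\<bar> < d \<Longrightarrow> norm (vel s y r - vel t y r) < e / 2"
    by (rule vel_time_modulus[OF half_gt_zero[OF \<open>e > 0\<close>], of "norm x0"]) blast
  note d = \<open>d > 0\<close> mod[OF _ t0 order_refl]
  define M where "M = K * bound x0"
  have M: "M > 0" using K_pos bound_pos by (simp add: M_def)
  define d' where "d' = min d (e / (2 * L * M))"
  have d': "d' > 0" using d(1) M L_pos \<open>e > 0\<close> by (simp add: d'_def)
  have traj_quot: "(z (t0 + \<delta>) - x0) /\<^sub>R \<delta> \<in> C"
    if \<delta>: "0 < \<delta>" "\<delta> < d'" "t0 + \<delta> \<le> T" and z: "traj t0 x0 z" for \<delta> z
  proof -
    obtain r where r: "\<And>s. s \<in> {0..T} \<Longrightarrow> r s \<in> P \<times> Q" "(\<lambda>s. vel s (z s) (r s)) integrable_on {0..T}"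
      "z t0 = x0"
      "\<And>s t. 0 \<le> s \<Longrightarrow> s \<le> t \<Longrightarrow> t \<le> T \<Longrightarrow> z t - z s = integral {s..t} (\<lambda>s. vel s (z s) (r s))"
      using z by (rule trajE) blast
    have "integral {t0..t0 + \<delta>} (\<lambda>s. vel s (z s) (r s)) /\<^sub>R (t0 + \<delta> - t0) \<in> C"
    proof (rule mean_in_closed_convex[OF _ C(2,1)])
      show "(\<lambda>s. vel s (z s) (r s)) integrable_on {t0..t0 + \<delta>}"
        by (rule integrable_on_subinterval[OF r(2)]) (use \<delta> t0 in auto)
      fix s assume s: "s \<in> {t0..t0 + \<delta>}"
      then have s': "s \<in> {0..T}" using \<delta> t0 by auto
      have "norm (z s - z t0) \<le> M * \<bar>s - t0\<bar>" unfolding M_def by (rule traj_lipschitz[OF z t0 t0 s'])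
      also have "\<dots> \<le> M * (e / (2 * L * M))"
        using s \<delta>(2) M by (intro mult_left_mono) (auto simp: d'_def)
      finally have "L * norm (z s - x0) \<le> L * (M * (e / (2 * L * M)))"
        using L_pos r(3) by (intro mult_left_mono) auto
      also have "\<dots> = e / 2" using L_pos M by simp
      finally have "norm (vel s (z s) (r s) - vel t0 x0 (r s)) \<le> e"
        using vel_deviation[OF s' r(1)[OF s'], of x0 t0 "e / 2" "z s"] d(2)[OF s' r(1)[OF s']] s \<delta>(2)
        by (auto simp: d'_def)
      then show "vel s (z s) (r s) \<in> C"
        unfolding memC velocities_eq using r(1)[OF s'] by (auto intro!: bexI[of _ "vel t0 x0 (r s)"] hull_inc)
    qed (use \<delta> in auto)
    then show ?thesis using r(3) r(4)[of t0 "t0 + \<delta>"] t0 \<delta> by simp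
  qed
  show ?thesis
  proof (rule that[OF d'])
    fix \<delta> y assume \<delta>: "0 < \<delta>" "\<delta> < d'" "t0 + \<delta> \<le> T" and y: "y \<in> Sol T P Q f g t0 x0"
    have "(y (t0 + \<delta>) - x0) /\<^sub>R \<delta> \<in> closure C"
      unfolding closure_approachable
    proof (intro allI impI)
      fix \<rho> :: real assume "\<rho> > 0"
      then have "\<rho> / 2 * \<delta> > 0" using \<delta> by simp
      then obtain z where z: "traj t0 x0 z" "\<forall>s\<in>{0..T}. dist (y s) (z s) \<le> \<rho> / 2 * \<delta>"
        using y unfolding mem_Sol_iff by blast
      have "(z (t0 + \<delta>) - x0) /\<^sub>R \<delta> - (y (t0 + \<delta>) - x0) /\<^sub>R \<delta> = (z (t0 + \<delta>) - y (t0 + \<delta>)) /\<^sub>R \<delta>"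
        by (simp add: algebra_simps)
      then have "dist ((z (t0 + \<delta>) - x0) /\<^sub>R \<delta>) ((y (t0 + \<delta>) - x0) /\<^sub>R \<delta>)
          = dist (y (t0 + \<delta>)) (z (t0 + \<delta>)) / \<delta>"
        using \<delta> by (simp add: dist_norm norm_minus_commute divide_inverse mult.commute)
      also have "\<dots> \<le> \<rho> / 2" using z(2) t0 \<delta> by (auto simp: divide_le_eq)
      finally show "\<exists>q\<in>C. dist q ((y (t0 + \<delta>) - x0) /\<^sub>R \<delta>) < \<rho>"
        using traj_quot[OF \<delta> z(1)] \<open>\<rho> > 0\<close> by (intro bexI) auto
    qed
    then show "\<exists>w\<in>?V. norm ((y (t0 + \<delta>) - x0) /\<^sub>R \<delta> - w) \<le> e"
      using C(1) memC by simp
  qed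
qed

lemma Sol_initial_velocity:
  assumes t0: "t0 \<in> {0..<T}" and y: "y \<in> Sol T P Q f g t0 x0"
  obtains w \<delta> W where "w \<in> velocities P Q f g t0 x0" "\<And>n :: nat. 0 < \<delta> n" "\<And>n. t0 + \<delta> n \<le> T"
    "\<delta> \<longlonglongrightarrow> 0" "W \<longlonglongrightarrow> w" "\<And>n. y (t0 + \<delta> n) = x0 + \<delta> n *\<^sub>R W n"
proof -
  let ?V = "velocities P Q f g t0 x0"
  define \<epsilon> where "\<epsilon> n = inverse (real (Suc n))" for n
  have \<epsilon>: "\<epsilon> n > 0" for n by (simp add: \<epsilon>_def)
  have \<epsilon>0: "\<epsilon> \<longlonglongrightarrow> 0" unfolding \<epsilon>_def by (rule LIMSEQ_inverse_real_of_nat)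
  have t0': "t0 \<in> {0..T}" using t0 by simp
  have "\<exists>\<delta> w. 0 < \<delta> \<and> \<delta> \<le> \<epsilon> n \<and> t0 + \<delta> \<le> T \<and> w \<in> ?V \<and> norm ((y (t0 + \<delta>) - x0) /\<^sub>R \<delta> - w) \<le> \<epsilon> n" for n
  proof -
    obtain d where d: "d > 0" "\<And>\<delta> y. 0 < \<delta> \<Longrightarrow> \<delta> < d \<Longrightarrow> t0 + \<delta> \<le> T \<Longrightarrow> y \<in> Sol T P Q f g t0 x0 \<Longrightarrow>
       \<exists>w\<in>?V. norm ((y (t0 + \<delta>) - x0) /\<^sub>R \<delta> - w) \<le> \<epsilon> n"
      using Sol_difference_quotient[OF t0' \<epsilon>, of x0 n] by metis
    define \<delta> where "\<delta> = min (d / 2) (min (\<epsilon> n) (T - t0))"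
    have "0 < \<delta>" "\<delta> < d" "\<delta> \<le> \<epsilon> n" "t0 + \<delta> \<le> T" using d(1) \<epsilon>[of n] t0 by (auto simp: \<delta>_def)
    with d(2)[OF _ _ _ y] show ?thesis by blast
  qed
  then obtain \<delta> v where \<delta>: "\<And>n. 0 < \<delta> n" "\<And>n. \<delta> n \<le> \<epsilon> n" "\<And>n. t0 + \<delta> n \<le> T" and v: "\<And>n. v n \<in> ?V"
    "\<And>n. norm ((y (t0 + \<delta> n) - x0) /\<^sub>R \<delta> n - v n) \<le> \<epsilon> n" by metis
  have "compact ?V" using t0' by (rule compact_velocities)
  then obtain w k where w: "w \<in> ?V" and k: "strict_mono (k :: nat \<Rightarrow> nat)" and lim: "(v \<circ> k) \<longlonglongrightarrow> w"
    using v(1) unfolding compact_def by metis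
  define W where "W n = (y (t0 + \<delta> (k n)) - x0) /\<^sub>R \<delta> (k n)" for n
  have \<epsilon>k: "(\<lambda>n. \<epsilon> (k n)) \<longlonglongrightarrow> 0" using LIMSEQ_subseq_LIMSEQ[OF \<epsilon>0 k] by (simp add: o_def)
  have "(\<lambda>n. W n - v (k n)) \<longlonglongrightarrow> 0"
    by (rule Lim_null_comparison[OF _ \<epsilon>k]) (use v(2) in \<open>auto simp: W_def\<close>)
  from tendsto_add[OF this lim] have "W \<longlonglongrightarrow> w" by (simp add: o_def)
  moreover have "(\<lambda>n. \<delta> (k n)) \<longlonglongrightarrow> 0"
    by (rule Lim_null_comparison[OF _ \<epsilon>k]) (use \<delta> in \<open>auto simp: less_imp_le\<close>)
  moreover have "y (t0 + \<delta> (k n)) = x0 + \<delta> (k n) *\<^sub>R W n" for n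
    using \<delta>(1)[of "k n"] by (simp add: W_def)
  ultimately show ?thesis using that[of w "\<lambda>n. \<delta> (k n)" W] w \<delta> by blast
qed

end

section \<open>The modulus derivative\<close>

lemma d_abs_nonneg:
  fixes w :: "real^'n"
  shows "0 \<le> d_abs c1 c2 t x w"
  unfolding d_abs_def
proof (rule Liminf_bounded)
  have "eventually (\<lambda>z. fst z > 0) (at_right (0::real) \<times>\<^sub>F nhds w)"
    unfolding eventually_prod_filter
    by (intro exI[of _ "\<lambda>\<delta>::real. \<delta> > 0"] exI[of _ "\<lambda>_::real^'n. True"])
       (auto simp: eventually_at_right_less)
  then show "eventually (\<lambda>z. 0 \<le> (case z of (\<delta>, w') \<Rightarrow>
      ereal ((\<bar>c1 (t + \<delta>) (x + \<delta> *\<^sub>R w') - c1 t x\<bar> + \<bar>c2 (t + \<delta>) (x + \<delta> *\<^sub>R w') - c2 t x\<bar>) / \<delta>)))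
      (at_right 0 \<times>\<^sub>F nhds w)"
    by eventually_elim auto
qed

lemma d_abs_lessD:
  assumes "d_abs c1 c2 t x w < ereal \<kappa>" "\<eta> > 0" "\<rho> > 0"
  obtains \<delta> w' where "0 < \<delta>" "\<delta> < \<eta>" "norm (w' - w) < \<rho>"
    "\<bar>c1 (t + \<delta>) (x + \<delta> *\<^sub>R w') - c1 t x\<bar> + \<bar>c2 (t + \<delta>) (x + \<delta> *\<^sub>R w') - c2 t x\<bar> < \<kappa> * \<delta>"
proof -
  define q where "q = (\<lambda>(\<delta>, w'). (\<bar>c1 (t + \<delta>) (x + \<delta> *\<^sub>R w') - c1 t x\<bar> +
      \<bar>c2 (t + \<delta>) (x + \<delta> *\<^sub>R w') - c2 t x\<bar>) / \<delta>)"
  let ?F = "at_right (0::real) \<times>\<^sub>F nhds w"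
  have "d_abs c1 c2 t x w = Liminf ?F (\<lambda>z. ereal (q z))"
    unfolding d_abs_def q_def by (rule arg_cong[where f="Liminf ?F"]) auto
  then have nev: "\<not> eventually (\<lambda>z. ereal \<kappa> \<le> ereal (q z)) ?F"
    using assms(1) Liminf_bounded[of "ereal \<kappa>" "\<lambda>z. ereal (q z)" ?F] by auto
  have ev: "eventually (\<lambda>z. 0 < fst z \<and> fst z < \<eta> \<and> norm (snd z - w) < \<rho>) ?F"
  proof -
    have "eventually (\<lambda>\<delta>::real. \<delta> \<in> {0<..<\<eta>}) (at_right 0)" using assms(2) by (rule eventually_at_right_real)
    moreover have "eventually (\<lambda>w'. dist w' w < \<rho>) (nhds w)" using assms(3) by (auto simp: eventually_nhds_metric)
    ultimately show ?thesis
      unfolding eventually_prod_filter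
      by (intro exI[of _ "\<lambda>\<delta>::real. \<delta> \<in> {0<..<\<eta>}"] exI[of _ "\<lambda>w'. dist w' w < \<rho>"]) (auto simp: dist_norm)
  qed
  from nev have "\<not> eventually (\<lambda>z. 0 < fst z \<and> fst z < \<eta> \<and> norm (snd z - w) < \<rho> \<longrightarrow> \<kappa> \<le> q z) ?F"
  proof (elim contrapos_nn)
    assume "eventually (\<lambda>z. 0 < fst z \<and> fst z < \<eta> \<and> norm (snd z - w) < \<rho> \<longrightarrow> \<kappa> \<le> q z) ?F"
    with ev show "eventually (\<lambda>z. ereal \<kappa> \<le> ereal (q z)) ?F" by eventually_elim simp
  qed
  then obtain z where "0 < fst z" "fst z < \<eta>" "norm (snd z - w) < \<rho>" "q z < \<kappa>"
    unfolding not_eventually by (auto dest!: frequently_ex simp: not_le)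
  then show ?thesis using that[of "fst z" "snd z"] by (auto simp: q_def divide_less_eq split: prod.splits)
qed

lemma d_abs_eq_0I:
  fixes \<delta> :: "nat \<Rightarrow> real"
  assumes "\<And>n. 0 < \<delta> n" "\<delta> \<longlonglongrightarrow> 0" "W \<longlonglongrightarrow> w"
    and "\<And>n. c1 (t + \<delta> n) (x + \<delta> n *\<^sub>R W n) = c1 t x" "\<And>n. c2 (t + \<delta> n) (x + \<delta> n *\<^sub>R W n) = c2 t x"
  shows "d_abs c1 c2 t x w = 0"
proof (rule antisym[OF _ d_abs_nonneg], rule ccontr)
  let ?F = "at_right (0::real) \<times>\<^sub>F nhds w"
  assume "\<not> d_abs c1 c2 t x w \<le> 0"
  then have "eventually (\<lambda>z. 0 < (case z of (\<delta>, w') \<Rightarrow>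
      ereal ((\<bar>c1 (t + \<delta>) (x + \<delta> *\<^sub>R w') - c1 t x\<bar> + \<bar>c2 (t + \<delta>) (x + \<delta> *\<^sub>R w') - c2 t x\<bar>) / \<delta>))) ?F"
    unfolding d_abs_def by (intro less_LiminfD) simp
  moreover have "filterlim \<delta> (at_right 0) sequentially"
    using assms(1,2) by (auto simp: filterlim_at intro!: always_eventually dest: less_imp_neq[symmetric])
  then have "filterlim (\<lambda>n. (\<delta> n, W n)) ?F sequentially"
    using assms(3) by (rule filterlim_Pair)
  ultimately have "eventually (\<lambda>n. 0 < (case (\<delta> n, W n) of (\<delta>, w') \<Rightarrow>
      ereal ((\<bar>c1 (t + \<delta>) (x + \<delta> *\<^sub>R w') - c1 t x\<bar> + \<bar>c2 (t + \<delta>) (x + \<delta> *\<^sub>R w') - c2 t x\<bar>) / \<delta>))) sequentially"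
    by (rule eventually_compose_filterlim)
  then show False using assms(4,5) by simp
qed

section \<open>The criterion for level-preserving motions\<close>

lemma control_system_if_regular:
  fixes P :: "'p::metric_space set" and Q :: "'q::metric_space set"
    and f :: "real \<Rightarrow> real^'n \<Rightarrow> 'p \<Rightarrow> real^'n" and g :: "real \<Rightarrow> real^'n \<Rightarrow> 'q \<Rightarrow> real^'n"
  assumes "0 < T" "compact P" "P \<noteq> {}" "compact Q" "Q \<noteq> {}"
    and f: "regular_dynamics T P f" and g: "regular_dynamics T Q g"
  obtains L K where "control_system T P Q f g L K"
proof -
  obtain Lf Kf where fc: "continuous_on ({0..T} \<times> UNIV \<times> P) (\<lambda>(t, x, u). f t x u)"
    and Lf: "\<And>t u. t \<in> {0..T} \<Longrightarrow> u \<in> P \<Longrightarrow> Lf-lipschitz_on UNIV (\<lambda>x. f t x u)"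
    and Kf: "\<And>t x u. t \<in> {0..T} \<Longrightarrow> u \<in> P \<Longrightarrow> norm (f t x u) \<le> Kf * (1 + norm x)"
    using f unfolding regular_dynamics_def by blast
  obtain Lg Kg where gc: "continuous_on ({0..T} \<times> UNIV \<times> Q) (\<lambda>(t, x, u). g t x u)"
    and Lg: "\<And>t u. t \<in> {0..T} \<Longrightarrow> u \<in> Q \<Longrightarrow> Lg-lipschitz_on UNIV (\<lambda>x. g t x u)"
    and Kg: "\<And>t x u. t \<in> {0..T} \<Longrightarrow> u \<in> Q \<Longrightarrow> norm (g t x u) \<le> Kg * (1 + norm x)"
    using g unfolding regular_dynamics_def by blast
  have "control_system T P Q f g (\<bar>Lf\<bar> + \<bar>Lg\<bar> + 1) (\<bar>Kf\<bar> + \<bar>Kg\<bar> + 1)"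
  proof unfold_locales
    have "continuous_on ({0..T} \<times> UNIV \<times> (P \<times> Q)) (\<lambda>z. f (fst z) (fst (snd z)) (fst (snd (snd z))))"
      by (rule continuous_on_compose2[OF fc, of _ "\<lambda>z. (fst z, fst (snd z), fst (snd (snd z)))", simplified])
         (auto intro!: continuous_intros)
    moreover have "continuous_on ({0..T} \<times> UNIV \<times> (P \<times> Q)) (\<lambda>z. g (fst z) (fst (snd z)) (snd (snd (snd z))))"
      by (rule continuous_on_compose2[OF gc, of _ "\<lambda>z. (fst z, fst (snd z), snd (snd (snd z)))", simplified])
         (auto intro!: continuous_intros)
    ultimately show "continuous_on ({0..T} \<times> UNIV \<times> P \<times> Q) (\<lambda>(t, x, r). f t x (fst r) + g t x (snd r))"
      unfolding case_prod_beta' by (rule continuous_on_add)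
  next
    fix t x y and r :: "'p \<times> 'q" assume t: "t \<in> {0..T}" and r: "r \<in> P \<times> Q"
    have "norm (f t x (fst r) - f t y (fst r)) \<le> Lf * norm (x - y)"
      using lipschitz_onD[OF Lf[OF t], of "fst r" x y] r by (auto simp: dist_norm)
    also have "\<dots> \<le> \<bar>Lf\<bar> * norm (x - y)" by (intro mult_right_mono) auto
    finally have 1: "norm (f t x (fst r) - f t y (fst r)) \<le> \<bar>Lf\<bar> * norm (x - y)" .
    have "norm (g t x (snd r) - g t y (snd r)) \<le> Lg * norm (x - y)"
      using lipschitz_onD[OF Lg[OF t], of "snd r" x y] r by (auto simp: dist_norm)
    also have "\<dots> \<le> \<bar>Lg\<bar> * norm (x - y)" by (intro mult_right_mono) auto
    finally have 2: "norm (g t x (snd r) - g t y (snd r)) \<le> \<bar>Lg\<bar> * norm (x - y)" .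
    have "f t x (fst r) + g t x (snd r) - (f t y (fst r) + g t y (snd r))
        = (f t x (fst r) - f t y (fst r)) + (g t x (snd r) - g t y (snd r))" by simp
    also have "norm \<dots> \<le> \<bar>Lf\<bar> * norm (x - y) + \<bar>Lg\<bar> * norm (x - y)"
      using 1 2 by (rule norm_triangle_mono)
    also have "\<dots> \<le> (\<bar>Lf\<bar> + \<bar>Lg\<bar> + 1) * norm (x - y)" by (simp add: distrib_right)
    finally show "norm (f t x (fst r) + g t x (snd r) - (f t y (fst r) + g t y (snd r)))
        \<le> (\<bar>Lf\<bar> + \<bar>Lg\<bar> + 1) * norm (x - y)" .
  next
    fix t x and r :: "'p \<times> 'q" assume t: "t \<in> {0..T}" and r: "r \<in> P \<times> Q"
    have "norm (f t x (fst r)) \<le> Kf * (1 + norm x)" using Kf[OF t] r by auto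
    also have "\<dots> \<le> \<bar>Kf\<bar> * (1 + norm x)" by (intro mult_right_mono) auto
    finally have 1: "norm (f t x (fst r)) \<le> \<bar>Kf\<bar> * (1 + norm x)" .
    have "norm (g t x (snd r)) \<le> Kg * (1 + norm x)" using Kg[OF t] r by auto
    also have "\<dots> \<le> \<bar>Kg\<bar> * (1 + norm x)" by (intro mult_right_mono) auto
    finally have 2: "norm (g t x (snd r)) \<le> \<bar>Kg\<bar> * (1 + norm x)" .
    have "norm (f t x (fst r) + g t x (snd r)) \<le> \<bar>Kf\<bar> * (1 + norm x) + \<bar>Kg\<bar> * (1 + norm x)"
      using 1 2 by (rule norm_triangle_mono)
    also have "\<dots> \<le> (\<bar>Kf\<bar> + \<bar>Kg\<bar> + 1) * (1 + norm x)"
      using norm_ge_zero[of x] by (simp add: distrib_right)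
    finally show "norm (f t x (fst r) + g t x (snd r)) \<le> (\<bar>Kf\<bar> + \<bar>Kg\<bar> + 1) * (1 + norm x)" .
  qed (use assms in \<open>auto intro: compact_Times\<close>)
  then show ?thesis by (rule that)
qed

theorem proposition3p2:
  fixes T :: real
    and P :: "'p::metric_space set" and Q :: "'q::metric_space set"
    and f :: "real \<Rightarrow> real^'n \<Rightarrow> 'p \<Rightarrow> real^'n"
    and g :: "real \<Rightarrow> real^'n \<Rightarrow> 'q \<Rightarrow> real^'n"
    and c1 c2 :: "real \<Rightarrow> real^'n \<Rightarrow> real"
  assumes "0 < T"
    and "compact P" "P \<noteq> {}"
    and "compact Q" "Q \<noteq> {}"
    and "regular_dynamics T P f"
    and "regular_dynamics T Q g"
    and "continuous_on ({0..T} \<times> UNIV) (\<lambda>(t, x). (c1 t x, c2 t x))"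
  shows "(\<forall>t0\<in>{0..T}. \<forall>x0. \<exists>y\<in>Sol T P Q f g t0 x0.
            \<forall>t\<in>{t0..T}. c1 t (y t) = c1 t0 x0 \<and> c2 t (y t) = c2 t0 x0)
    \<longleftrightarrow>
         (\<forall>t\<in>{0..<T}. \<forall>x. (INF w\<in>velocities P Q f g t x. d_abs c1 c2 t x w) = 0)"
    (is "?motions \<longleftrightarrow> ?inf")
proof -
  obtain L K where "control_system T P Q f g L K" using control_system_if_regular[OF assms(1-7)] .
  then interpret control_system T P Q f g "\<lambda>t x r. f t x (fst r) + g t x (snd r)" L K .
  show ?thesis
  proof
    assume m: ?motions
    show ?inf
    proof (intro ballI allI)
      fix t x assume t: "t \<in> {0..<T}"
      then obtain y where y: "y \<in> Sol T P Q f g t x"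
        and const: "\<And>s. s \<in> {t..T} \<Longrightarrow> c1 s (y s) = c1 t x \<and> c2 s (y s) = c2 t x"
        using m by (metis atLeastAtMost_iff atLeastLessThan_iff less_imp_le)
      obtain w \<delta> W where w: "w \<in> velocities P Q f g t x" "\<And>n :: nat. 0 < \<delta> n" "\<And>n. t + \<delta> n \<le> T"
        "\<delta> \<longlonglongrightarrow> 0" "W \<longlonglongrightarrow> w" "\<And>n. y (t + \<delta> n) = x + \<delta> n *\<^sub>R W n"
        using Sol_initial_velocity[OF t y] by blast
      have "c1 (t + \<delta> n) (x + \<delta> n *\<^sub>R W n) = c1 t x \<and> c2 (t + \<delta> n) (x + \<delta> n *\<^sub>R W n) = c2 t x" for n
        using const[of "t + \<delta> n"] w(2)[of n] w(3)[of n] w(6)[of n] by simp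
      then have "d_abs c1 c2 t x w = 0" using w by (intro d_abs_eq_0I[of \<delta> W]) auto
      then have "(INF w\<in>velocities P Q f g t x. d_abs c1 c2 t x w) \<le> 0"
        using w(1) by (metis INF_lower)
      then show "(INF w\<in>velocities P Q f g t x. d_abs c1 c2 t x w) = 0"
        by (intro antisym INF_greatest d_abs_nonneg)
    qed
  next
    assume i: ?inf
    let ?c = "\<lambda>t x. (c1 t x, c2 t x)"
    have st: "\<exists>s x'. level_step ?c \<kappa> \<eta> t x s x'" if t: "t \<in> {0..<T}" and "\<kappa> > 0" "\<eta> > 0" for t x \<kappa> \<eta>
    proof -
      have "(INF w\<in>velocities P Q f g t x. d_abs c1 c2 t x w) < ereal \<kappa>"
        using i t \<open>\<kappa> > 0\<close> by simp
      then obtain w where w: "w \<in> velocities P Q f g t x" "d_abs c1 c2 t x w < ereal \<kappa>"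
        unfolding INF_less_iff by blast
      obtain \<delta> w' where \<delta>: "0 < \<delta>" "\<delta> < min \<eta> (T - t)" "norm (w' - w) < \<kappa>"
        "\<bar>c1 (t + \<delta>) (x + \<delta> *\<^sub>R w') - c1 t x\<bar> + \<bar>c2 (t + \<delta>) (x + \<delta> *\<^sub>R w') - c2 t x\<bar> < \<kappa> * \<delta>"
        by (rule d_abs_lessD[OF w(2), of "min \<eta> (T - t)" \<kappa>]) (use t \<open>\<kappa> > 0\<close> \<open>\<eta> > 0\<close> in auto)
      have "norm (?c (t + \<delta>) (x + \<delta> *\<^sub>R w') - ?c t x) < \<kappa> * \<delta>"
        using norm_Pair_le[of "c1 (t + \<delta>) (x + \<delta> *\<^sub>R w') - c1 t x" "c2 (t + \<delta>) (x + \<delta> *\<^sub>R w') - c2 t x"] \<delta>(4)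
        by simp
      moreover have "norm (x + \<delta> *\<^sub>R w' - x - (t + \<delta> - t) *\<^sub>R w) < \<kappa> * (t + \<delta> - t)"
      proof -
        have "x + \<delta> *\<^sub>R w' - x - (t + \<delta> - t) *\<^sub>R w = \<delta> *\<^sub>R (w' - w)" by (simp add: algebra_simps)
        then show ?thesis using \<delta>(1,3) by (simp add: mult.commute)
      qed
      ultimately have "level_step ?c \<kappa> \<eta> t x (t + \<delta>) (x + \<delta> *\<^sub>R w')"
        unfolding level_step_def using \<delta>(1,2) w(1) by auto
      then show ?thesis by blast
    qed
    show ?motions
    proof (intro ballI allI)
      fix t0 x0 assume t0: "t0 \<in> {0..T}"
      obtain y where "y \<in> Sol T P Q f g t0 x0" "\<And>t. t \<in> {t0..T} \<Longrightarrow> ?c t (y t) = ?c t0 x0"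
        by (rule level_motion[OF assms(8) _ t0, of x0]) (use st in blast)+
      then show "\<exists>y\<in>Sol T P Q f g t0 x0. \<forall>t\<in>{t0..T}. c1 t (y t) = c1 t0 x0 \<and> c2 t (y t) = c2 t0 x0"
        by blast
    qed
  qed
qed

end
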